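(* Let $N\ge 2$ and let $X\in\mathrm{Herm}(N)$ be a non-zero random matrix drawn from an invariant stable ensemble (stable and unitarily invariant, not a Dirac measure) with probability distribution $F$. Then exactly one of the following three statements is true: (1) $F$ is a stable distribution on an $N^2$-dimensional subspace of $\mathrm{Herm}(N)$ (i.e. on all of $\mathrm{Herm}(N)$), and it is bounded and continuous on $\mathrm{Herm}(N)$ (i.e. it has a bounded continuous probability density there); (2) there is a $t\in\mathbb{R}$ such that $F$ is a stable distribution with support restricted to the set of fixed-trace Hermitian matrices $\mathrm{Herm}_t(N):=\{X\in\mathrm{Herm}(N):\mathrm{Tr}\,X=t\}$, and it is bounded and continuous thereon (i.e. it has a bounded continuous probability density with respect to Lebesgue measure on $\mathrm{Herm}_t(N)$); (3) $F$ is a stable distribution with support restricted to the $1$-dimensional subspace $\{xI_N:x\in\mathbb{R}\}\subset\mathrm{Herm}(N)$, while the traceless part of the random matrix $X$ always vanishes.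
   Context: $\mathrm{Herm}(N)$ is the real vector space of $N\times N$ complex Hermitian matrices, identified with $\mathbb{R}^{N^2}$; $\mathrm{U}(N)$ is the unitary group. A random matrix $X\in\mathrm{Herm}(N)$ (or its distribution) is stable if there are $B>0$ and $A\in\mathrm{Herm}(N)$ such that, for two independent copies $X_1,X_2$ of $X$, $X$ has the same distribution as $\frac1B(X_1+X_2-A)$. It is unitarily invariant if $X$ has the same distribution as $UXU^\dagger$ for every $U\in\mathrm{U}(N)$. An invariant stable ensemble is a stable and unitarily invariant distribution on $\mathrm{Herm}(N)$. Dirac measures at a fixed Hermitian matrix are excluded from the stable distributions. Known classification (may be used): the characteristic function of an invariant stable ensemble is $$\mathbb{E}\exp(i\,\mathrm{Tr}\,SX)=\exp\Big(-\sigma\int_{\mathbb{S}_{\mathrm{Herm}(N)}}H(\mathrm{d}R)\,\nu_\alpha(\mathrm{Tr}\,RS)+i\mu\,\mathrm{Tr}\,S\Big),\quad S\in\mathrm{Herm}(N),$$ with $\alpha\in(0,2]$, $\sigma>0$, $\mu\in\mathbb{R}$, $H$ a Borel probability measure on the unit sphere $\mathbb{S}_{\mathrm{Herm}(N)}=\{R\in\mathrm{Herm}(N):\mathrm{Tr}\,R^2=1\}$ invariant under $R\mapsto URU^\dagger$ for all $U\in\mathrm{U}(N)$, and $\nu_\alpha(u)=|u|^\alpha\big(1-i\,\mathrm{sgn}(u)\tan\frac{\pi\alpha}{2}\big)$ for $\alpha\ne1$, $\nu_1(u)=|u|\big(1+\frac{2i}{\pi}\mathrm{sgn}(u)\log|u|\big)$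 (with $\nu_1(0)=0$). *)

theory Defs
  imports "HOL-Probability.Probability"
begin

definition conj_transpose :: "complex^'n^'n \<Rightarrow> complex^'n^'n" where
  "conj_transpose A = map_matrix cnj (transpose A)"

definition herm :: "(complex^'n^'n) set" where
  "herm = {A. conj_transpose A = A}"

definition herm_trace :: "real \<Rightarrow> (complex^'n^'n) set" where
  "herm_trace t = {A \<in> herm. trace A = complex_of_real t}"

definition unitary :: "complex^'n^'n \<Rightarrow> bool" where
  "unitary U \<longleftrightarrow> U ** conj_transpose U = mat 1 \<and> conj_transpose U ** U = mat 1"

definition traceless_part :: "complex^'n^'n \<Rightarrow> complex^'n^'n" where
  "traceless_part A = A - mat (trace A / of_nat CARD('n))"

(* The topological support of a Borel measure. *)
definition msupport :: "'a::topological_space measure \<Rightarrow> 'a set" where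
  "msupport F = {x. \<forall>U. open U \<longrightarrow> x \<in> U \<longrightarrow> emeasure F U > 0}"

(* Distributions on the real vector space herm are represented as Borel probability measures
   on the ambient matrix space that are supported in herm.  Under the product measure of F with
   itself, the two coordinates x and y are independent copies of a random matrix with
   distribution F.  The last conjunct excludes the Dirac measures. *)
definition stable_distribution :: "(complex^'n^'n) measure \<Rightarrow> bool" where
  "stable_distribution F \<longleftrightarrow>
     prob_space F \<and> sets F = sets borel \<and> msupport F \<subseteq> herm \<and>
     (\<exists>B::real. B > 0 \<and> (\<exists>A\<in>herm.
        F = distr (F \<Otimes>\<^sub>M F) borel (\<lambda>(x, y). (1 / B) *\<^sub>R (x + y - A)))) \<and>
     (\<forall>A\<in>herm. F \<noteq> return borel A)"

definition unitarily_invariant :: "(complex^'n^'n) measure \<Rightarrow> bool" where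
  "unitarily_invariant F \<longleftrightarrow>
     (\<forall>U. unitary U \<longrightarrow> distr F borel (\<lambda>x. U ** x ** conj_transpose U) = F)"

definition invariant_stable_ensemble :: "(complex^'n^'n) measure \<Rightarrow> bool" where
  "invariant_stable_ensemble F \<longleftrightarrow> stable_distribution F \<and> unitarily_invariant F"

(* The inner product of the ambient matrix space restricts to Tr (A B) on herm, so orthonormality
   below refers to the Euclidean structure in which the unit sphere is Tr R^2 = 1. *)
lemma inner_herm:
  fixes A B :: "complex^'n^'n"
  assumes "A \<in> herm"
  shows "A \<bullet> B = Re (trace (A ** B))"
proof -
  have "A $ i $ j = cnj (A $ j $ i)" for i j
    using assms unfolding herm_def conj_transpose_def
    by (auto simp: vec_eq_iff transpose_def)
  then have "A $ i $ j \<bullet> B $ i $ j = Re (A $ j $ i * B $ i $ j)" for i j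
    by (metis cnj.sel(1) cnj.sel(2) inner_complex_def minus_mult_left
        diff_minus_eq_add times_complex.sel(1))
  then have "A \<bullet> B = (\<Sum>i\<in>UNIV. \<Sum>j\<in>UNIV. Re (A $ j $ i * B $ i $ j))"
    by (simp add: inner_vec_def)
  also have "\<dots> = (\<Sum>j\<in>UNIV. \<Sum>i\<in>UNIV. Re (A $ j $ i * B $ i $ j))"
    by (rule sum.swap)
  finally show ?thesis
    by (simp add: trace_def matrix_matrix_mult_def)
qed

definition orthonormal_frame :: "'a::euclidean_space set \<Rightarrow> 'a \<Rightarrow> 'a set \<Rightarrow> bool" where
  "orthonormal_frame S a B \<longleftrightarrow>
     a \<in> S \<and> pairwise orthogonal B \<and> (\<forall>b\<in>B. norm b = 1) \<and> S = {a + v | v. v \<in> span B}"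

lemma orthonormal_frame_exists:
  fixes S :: "'a::euclidean_space set"
  assumes "affine S" "S \<noteq> {}"
  shows "\<exists>a B. orthonormal_frame S a B"
proof -
  obtain a where a: "a \<in> S" using assms by blast
  have "subspace ((\<lambda>x. - a + x) ` S)"
    using affine_diffs_subspace [OF assms(1) a] by simp
  then obtain B where B: "pairwise orthogonal B" "\<And>x. x \<in> B \<Longrightarrow> norm x = 1"
      "span B = (\<lambda>x. - a + x) ` S"
    by (rule orthonormal_basis_subspace) blast
  have "S = {a + v | v. v \<in> span B}"
    by (force simp: B(3))
  then show ?thesis
    unfolding orthonormal_frame_def using a B(1,2) by blast
qed

(* Lebesgue measure on a nonempty affine subspace S, as a Borel measure on the ambient space: the
   image of Lebesgue measure under a Cartesian coordinate system of S.  Translation and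
   rotation invariance of Lebesgue measure make it independent of the chosen system. *)
definition affine_lebesgue :: "'a::euclidean_space set \<Rightarrow> 'a measure" where
  "affine_lebesgue S =
     (let (a, B) = (SOME (a, B). orthonormal_frame S a B)
      in distr (\<Pi>\<^sub>M b\<in>B. (lborel :: real measure)) borel (\<lambda>c. a + (\<Sum>b\<in>B. c b *\<^sub>R b)))"

definition has_bounded_continuous_density_on :: "'a::euclidean_space measure \<Rightarrow> 'a set \<Rightarrow> bool" where
  "has_bounded_continuous_density_on F S \<longleftrightarrow>
     (\<exists>p::'a \<Rightarrow> real. (\<forall>x\<in>S. 0 \<le> p x) \<and> bounded (p ` S) \<and> continuous_on S p \<and>
        F = density (affine_lebesgue S) (\<lambda>x. ennreal (p x) * indicator S x))"

lemma subspace_herm: "subspace (herm :: (complex^'n^'n) set)"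
  by (auto simp: subspace_def herm_def conj_transpose_def transpose_def vec_eq_iff)

lemma affine_herm_trace: "affine (herm_trace t :: (complex^'n^'n) set)"
proof -
  have tr: "trace (u *\<^sub>R x + v *\<^sub>R y) = u *\<^sub>R trace x + v *\<^sub>R trace y"
    for u v and x y :: "complex^'n^'n"
    by (simp add: trace_def sum.distrib scaleR_sum_right)
  show ?thesis
    unfolding affine_def herm_trace_def
    by (auto simp: tr subspace_add subspace_scale subspace_herm)
       (metis of_real_add of_real_1 distrib_right mult_1 scaleR_conv_of_real)
qed

lemma herm_trace_nonempty: "herm_trace t \<noteq> ({} :: (complex^'n^'n) set)"
proof -
  have "mat (complex_of_real (t / of_nat CARD('n))) \<in> (herm_trace t :: (complex^'n^'n) set)"
    by (auto simp: herm_trace_def herm_def conj_transpose_def transpose_def vec_eq_iff mat_def trace_def)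
  then show ?thesis by blast
qed

end

theory Submission
  imports Defs
begin

text \<open>
  The canonical representation of the characteristic function is not needed. The relation between two
  independent copies and one copy gives \<open>|\<phi> (b s)| = |\<phi> s|\<^sup>2\<close> for the characteristic function, with
  \<open>b > 1\<close> because the distribution is not a Dirac measure. Hence \<open>|\<phi> s| = 1\<close> forces
  \<open>|\<phi> (s / b ^ k)| = 1\<close> for all \<open>k\<close>, so that \<open>Tr s X\<close> is almost surely constant; and on a subspace
  without nonzero directions of this kind \<open>|\<phi>|\<close> is at most some \<open>q < 1\<close> on the shell
  \<open>1 \<le> |s| \<le> b\<close>, hence decays faster than every power, and Fourier inversion yields a bounded
  continuous density. The constant directions form a unitarily invariant subspace of the Hermitian
  matrices, and such a subspace either contains all traceless matrices or consists of multiples of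
  the identity. If it contains the traceless ones, then conjugation by a diagonal sign matrix
  reverses an off-diagonal direction, so the constant is \<open>0\<close> and the traceless part of \<open>X\<close> vanishes.
\<close>

subsection \<open>Characteristic functions on Euclidean spaces\<close>

text \<open>Passing to moduli is what makes the stability relation usable: the shift
  \<open>A\<close> becomes a phase, which the modulus removes. A single vector with |phi s| = 1
  confines Tr s X only to a coset of a lattice; the vectors s / b^k refine the lattice until one
  point is left. The obstacle on the analytic side is that a density may live on a proper affine
  subspace, so that the ambient characteristic function does not decay in every direction. Inversion
  is therefore carried out in coordinates of the subspace, after adding Gaussian noise of size e:
  the Gaussian weight justifies the exchange of integrals, and the limit e -> 0 is taken under the
  integrable bound |phi|. The assumption N >= 2 supplies off-diagonal directions; for N = 1 every
  Hermitian matrix is scalar and statements (1) and (3) would overlap. The three statements exclude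
  each other because a density on all of \<open>herm\<close> gives hyperplanes measure zero, and
  because a scalar matrix of fixed trace is one fixed matrix, whose Dirac measure is ruled
  out.\<close>

definition cf :: "'a::euclidean_space measure \<Rightarrow> 'a \<Rightarrow> complex" where
  "cf F s = (CLINT x|F. iexp (s \<bullet> x))"

lemma borel_measurable_iexp[measurable (raw)]:
  assumes "(f :: _ \<Rightarrow> real) \<in> borel_measurable M"
  shows "(\<lambda>x. iexp (f x)) \<in> borel_measurable M"
  by (rule measurable_compose[OF assms]) (intro borel_measurable_continuous_onI continuous_intros)

lemma integrable_iexp_inner:
  fixes F :: "'a::euclidean_space measure"
  assumes "prob_space F" "sets F = sets borel"
  shows "integrable F (\<lambda>x. iexp (s \<bullet> x))"
proof -
  interpret prob_space F by fact
  have [measurable_cong]: "sets F = sets borel" by fact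
  show ?thesis
    by (rule integrable_const_bound[where B=1]) (simp, measurable)
qed

lemma cf_norm_le_1:
  assumes "prob_space F" "sets F = sets borel"
  shows "cmod (cf F s) \<le> 1"
proof -
  interpret prob_space F by fact
  have "cmod (cf F s) \<le> (\<integral>x. cmod (iexp (s \<bullet> x)) \<partial>F)"
    unfolding cf_def by (rule integral_norm_bound)
  then show ?thesis by (simp add: prob_space)
qed

lemma continuous_on_cf:
  assumes "prob_space F" "sets F = sets borel"
  shows "continuous_on A (cf F)"
proof (rule continuous_on_sequentiallyI)
  interpret prob_space F by fact
  have [measurable_cong]: "sets F = sets borel" by fact
  fix u :: "nat \<Rightarrow> 'a" and a assume u: "u \<longlonglongrightarrow> a"
  show "(\<lambda>n. cf F (u n)) \<longlonglongrightarrow> cf F a"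
    unfolding cf_def
  proof (rule integral_dominated_convergence[where w="\<lambda>_. 1"])
    show "AE x in F. (\<lambda>n. iexp (u n \<bullet> x)) \<longlonglongrightarrow> iexp (a \<bullet> x)"
      using u by (auto intro!: tendsto_intros)
  qed auto
qed

subsection \<open>Gaussian densities\<close>

text \<open>The substitution x = e s in the characteristic function of the standard normal law at -
  u / e. It presents the Gaussian density of width e as a Fourier integral with a Gaussian weight,
  the one-dimensional ingredient of \<open>kernel_fourier\<close>.\<close>

lemma normal_density_fourier:
  assumes e: "e > 0"
  shows "has_bochner_integral lborel
    (\<lambda>s. iexp (- (u * s)) * complex_of_real (exp (- (e\<^sup>2 * s\<^sup>2) / 2)))
    (complex_of_real (2 * pi * normal_density 0 e u))"
proof -
  let ?g = "\<lambda>x. std_normal_density x *\<^sub>R iexp (- (u / e) * x)"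
  interpret real_distribution std_normal_distribution by (rule real_dist_normal_dist)
  have "integrable std_normal_distribution (\<lambda>x. iexp (- (u / e) * x))"
    by (rule integrable_iexp) auto
  then have int: "integrable lborel ?g"
    by (subst (asm) integrable_density) (auto simp: normal_density_nonneg)
  have "char std_normal_distribution (- (u / e)) = integral\<^sup>L lborel ?g"
    unfolding char_def by (subst integral_density) (auto simp: normal_density_nonneg)
  then have "has_bochner_integral lborel ?g (complex_of_real (exp (- (u / e)\<^sup>2 / 2)))"
    using int by (simp add: has_bochner_integral_iff char_std_normal_distribution)
  then have "has_bochner_integral lborel (\<lambda>s. ?g (0 + e * s)) (complex_of_real (exp (- (u / e)\<^sup>2 / 2)) /\<^sub>R \<bar>e\<bar>)"
    using e by (subst (asm) lborel_has_bochner_integral_real_affine_iff[where c=e and t=0]) simp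
  moreover have "?g (0 + e * s) = (1 / sqrt (2 * pi) * exp (- (e\<^sup>2 * s\<^sup>2) / 2)) *\<^sub>R iexp (- (u * s))" for s
  proof -
    have "- (u / e) * (0 + e * s) = - (u * s)" using e by simp
    moreover have "(0 + e * s)\<^sup>2 = e\<^sup>2 * s\<^sup>2" by (simp add: power_mult_distrib)
    ultimately show ?thesis by (simp only: std_normal_density_def minus_mult_left)
  qed
  ultimately have "has_bochner_integral lborel (\<lambda>s. (1 / sqrt (2 * pi) * exp (- (e\<^sup>2 * s\<^sup>2) / 2)) *\<^sub>R iexp (- (u * s)))
      (complex_of_real (exp (- (u / e)\<^sup>2 / 2)) /\<^sub>R \<bar>e\<bar>)"
    by simp
  then have "has_bochner_integral lborel 
     (\<lambda>s. sqrt (2 * pi) *\<^sub>R (1 / sqrt (2 * pi) * exp (- (e\<^sup>2 * s\<^sup>2) / 2)) *\<^sub>R iexp (- (u * s)))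
      (sqrt (2 * pi) *\<^sub>R (complex_of_real (exp (- (u / e)\<^sup>2 / 2)) /\<^sub>R \<bar>e\<bar>))"
    by (rule has_bochner_integral_scaleR_right)
  moreover have "sqrt (2 * pi) *\<^sub>R (complex_of_real (exp (- (u / e)\<^sup>2 / 2)) /\<^sub>R \<bar>e\<bar>)
      = complex_of_real (2 * pi * normal_density 0 e u)"
  proof -
    have "sqrt (2 * pi) * inverse \<bar>e\<bar> = 2 * pi / sqrt (2 * pi * e\<^sup>2)"
      using e real_div_sqrt[of "2 * pi"] by (simp add: real_sqrt_mult[of "2 * pi"] divide_inverse flip: divide_divide_eq_left)
    then have "sqrt (2 * pi) * (inverse \<bar>e\<bar> * exp (- (u / e)\<^sup>2 / 2)) = 2 * pi * normal_density 0 e u"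
      by (simp add: normal_density_def power_divide mult.commute flip: mult.assoc)
    then show ?thesis
      by (simp only: scaleR_conv_of_real flip: of_real_mult)
  qed
  moreover have "(\<lambda>s. sqrt (2 * pi) *\<^sub>R (1 / sqrt (2 * pi) * exp (- (e\<^sup>2 * s\<^sup>2) / 2)) *\<^sub>R iexp (- (u * s))) =
     (\<lambda>s. iexp (- (u * s)) * complex_of_real (exp (- (e\<^sup>2 * s\<^sup>2) / 2)))"
    by (auto simp: scaleR_conv_of_real fun_eq_iff)
  ultimately show ?thesis by simp
qed

lemma distr_normal_affine:
  assumes e: "e > 0"
  shows "distr std_normal_distribution lborel (\<lambda>x. m + e * x)
    = density lborel (\<lambda>x. ennreal (normal_density m e x))"
proof (rule measure_eqI)
  fix A :: "real set" assume "A \<in> sets (distr std_normal_distribution lborel (\<lambda>x. m + e * x))"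
  then have [measurable]: "A \<in> sets borel" by simp
  have "emeasure (distr std_normal_distribution lborel (\<lambda>x. m + e * x)) A
      = (\<integral>\<^sup>+x. indicator A x \<partial>distr std_normal_distribution lborel (\<lambda>x. m + e * x))"
    by (simp add: nn_integral_indicator)
  also have "\<dots> = (\<integral>\<^sup>+x. indicator A (m + e * x) \<partial>std_normal_distribution)"
    by (rule nn_integral_distr) auto
  also have "\<dots> = (\<integral>\<^sup>+x. ennreal (std_normal_density x) * indicator A (m + e * x) \<partial>lborel)"
    by (rule nn_integral_density) auto
  \<comment> \<open>The standard density at x is e times the density with mean m and deviation e at
    m + e x; this e is the Jacobian absorbed by the affine change of variables below.\<close>
  also have "\<dots> = (\<integral>\<^sup>+x. ennreal e * (ennreal (normal_density m e (m + e * x)) * indicator A (m + e * x)) \<partial>lborel)"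
    using e by (auto intro!: nn_integral_cong simp: normal_density_def real_sqrt_mult power_mult_distrib
        simp flip: ennreal_mult' split: split_indicator)
  also have "\<dots> = ennreal e * (\<integral>\<^sup>+x. (ennreal (normal_density m e (m + e * x)) * indicator A (m + e * x)) \<partial>lborel)"
    by (rule nn_integral_cmult) auto
  also have "\<dots> = (\<integral>\<^sup>+x. ennreal (normal_density m e x) * indicator A x \<partial>lborel)"
    using e by (subst nn_integral_real_affine[where c=e and t=m and
          f="\<lambda>x. ennreal (normal_density m e x) * indicator A x"]) auto
  also have "\<dots> = emeasure (density lborel (\<lambda>x. ennreal (normal_density m e x))) A"
    by (simp add: emeasure_density)
  finally show "emeasure (distr std_normal_distribution lborel (\<lambda>x. m + e * x)) A = \<dots>" .
qed simp

interpretation lborel_product: product_sigma_finite "\<lambda>_. lborel :: real measure"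
  by standard

text \<open>Both sides agree on rectangles by Tonelli, and sigma-finiteness of the factors makes the
  product measure the only one with these values.\<close>

lemma PiM_density_lborel:
  fixes f :: "'i \<Rightarrow> real \<Rightarrow> ennreal"
  assumes fin: "finite I" and [measurable]: "\<And>i. f i \<in> borel_measurable borel"
    and sf: "\<And>i. sigma_finite_measure (density lborel (f i))"
  shows "density (PiM I (\<lambda>_. lborel)) (\<lambda>c. \<Prod>i\<in>I. f i (c i)) = PiM I (\<lambda>i. density lborel (f i))"
proof -
  interpret product_sigma_finite "\<lambda>i. density lborel (f i)"
    using sf by (simp add: product_sigma_finite_def)
  show ?thesis
  proof (rule PiM_eqI[OF fin])
    show "sets (density (PiM I (\<lambda>_. lborel)) (\<lambda>c. \<Prod>i\<in>I. f i (c i))) =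
        sets (Pi\<^sub>M I (\<lambda>i. density lborel (f i)))"
      by (simp cong: sets_PiM_cong)
  next
    fix A assume A: "\<And>i. i \<in> I \<Longrightarrow> A i \<in> sets (density lborel (f i))"
    then have [measurable]: "\<And>i. i \<in> I \<Longrightarrow> A i \<in> sets borel" by simp
    have [measurable]: "Pi\<^sub>E I A \<in> sets (PiM I (\<lambda>_. lborel))"
      using A by (intro sets_PiM_I_finite fin) auto
    have "emeasure (density (PiM I (\<lambda>_. lborel)) (\<lambda>c. \<Prod>i\<in>I. f i (c i))) (Pi\<^sub>E I A)
       = (\<integral>\<^sup>+c. (\<Prod>i\<in>I. f i (c i)) * indicator (Pi\<^sub>E I A) c \<partial>PiM I (\<lambda>_. lborel))"
      by (rule emeasure_density) measurable
    also have "\<dots> = (\<integral>\<^sup>+c. (\<Prod>i\<in>I. f i (c i) * indicator (A i) (c i)) \<partial>PiM I (\<lambda>_. lborel))"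
    proof (rule nn_integral_cong)
      fix c :: "'i \<Rightarrow> real" assume "c \<in> space (PiM I (\<lambda>_. lborel))"
      then have "indicator (Pi\<^sub>E I A) c = (\<Prod>i\<in>I. indicator (A i) (c i) :: ennreal)"
        using fin by (auto simp: space_PiM PiE_iff indicator_def prod_zero_iff)
      then show "(\<Prod>i\<in>I. f i (c i)) * indicator (Pi\<^sub>E I A) c
          = (\<Prod>i\<in>I. f i (c i) * indicator (A i) (c i))"
        by (simp add: prod.distrib)
    qed
    also have "\<dots> = (\<Prod>i\<in>I. \<integral>\<^sup>+x. f i x * indicator (A i) x \<partial>lborel)"
      using fin by (rule lborel_product.product_nn_integral_prod) auto
    also have "\<dots> = (\<Prod>i\<in>I. emeasure (density lborel (f i)) (A i))"
      using A by (intro prod.cong refl emeasure_density[symmetric]) auto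
    finally show "emeasure (density (PiM I (\<lambda>_. lborel)) (\<lambda>c. \<Prod>i\<in>I. f i (c i))) (Pi\<^sub>E I A) = \<dots>" .
  qed
qed

text \<open>Shifting and scaling act on each coordinate separately, so on rectangles the claim
  reduces to \<open>distr_normal_affine\<close>. The restriction to \<open>I\<close> keeps the image
  inside the extensional functions of \<open>PiM\<close>.\<close>

lemma distr_PiM_normal_affine:
  fixes m :: "'i \<Rightarrow> real"
  assumes fin: "finite I" and e: "e > 0"
  shows "distr (PiM I (\<lambda>_. std_normal_distribution)) (PiM I (\<lambda>_. lborel)) (\<lambda>z. \<lambda>i\<in>I. m i + e * z i)
    = density (PiM I (\<lambda>_. lborel)) (\<lambda>c. ennreal (\<Prod>i\<in>I. normal_density (m i) e (c i)))" (is "?D = _")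
proof -
  interpret S: product_prob_space "\<lambda>_::'i. std_normal_distribution"
    by (rule product_prob_spaceI) (rule prob_space_normal_density, simp)
  have prob: "prob_space (density lborel (\<lambda>x. ennreal (normal_density (m i) e x)))" for i
    using e by (rule prob_space_normal_density)
  interpret P: product_prob_space "\<lambda>i. density lborel (\<lambda>x. ennreal (normal_density (m i) e x))"
    by (rule product_prob_spaceI) (rule prob)
  have mS[measurable_cong]: "sets (PiM I (\<lambda>_. std_normal_distribution)) = sets (PiM I (\<lambda>_. lborel))"
    by (auto intro!: sets_PiM_cong)
  have aff[measurable]: "(\<lambda>z. \<lambda>i\<in>I. m i + e * z i) \<in>
      PiM I (\<lambda>_. std_normal_distribution) \<rightarrow>\<^sub>M PiM I (\<lambda>_. lborel)"
    by measurable
  have "?D = PiM I (\<lambda>i. density lborel (\<lambda>x. ennreal (normal_density (m i) e x)))"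
  proof (rule P.PiM_eqI[OF fin])
    show "sets ?D = sets (PiM I (\<lambda>i. density lborel (\<lambda>x. ennreal (normal_density (m i) e x))))"
      by (simp cong: sets_PiM_cong)
  next
    fix A assume A: "\<And>i. i \<in> I \<Longrightarrow> A i \<in> sets (density lborel (\<lambda>x. ennreal (normal_density (m i) e x)))"
    then have [measurable]: "\<And>i. i \<in> I \<Longrightarrow> A i \<in> sets borel" by simp
    have PA: "Pi\<^sub>E I A \<in> sets (PiM I (\<lambda>_. lborel))"
      using A by (intro sets_PiM_I_finite fin) auto
    have vi: "(\<lambda>x. m i + e * x) -` A i \<in> sets borel" if "i \<in> I" for i
      using measurable_sets[of "\<lambda>x. m i + e * x" borel borel "A i"] A[OF that] by simp
    have "emeasure ?D (Pi\<^sub>E I A) = emeasure (PiM I (\<lambda>_. std_normal_distribution))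
       ((\<lambda>z. \<lambda>i\<in>I. m i + e * z i) -` Pi\<^sub>E I A \<inter> space (PiM I (\<lambda>_. std_normal_distribution)))"
      using aff PA by (rule emeasure_distr)
    also have "(\<lambda>z. \<lambda>i\<in>I. m i + e * z i) -` Pi\<^sub>E I A \<inter> space (PiM I (\<lambda>_. std_normal_distribution))
       = Pi\<^sub>E I (\<lambda>i. (\<lambda>x. m i + e * x) -` A i)"
      by (auto simp: space_PiM PiE_iff)
    also have "emeasure (PiM I (\<lambda>_. std_normal_distribution)) \<dots> =
       (\<Prod>i\<in>I. emeasure std_normal_distribution ((\<lambda>x. m i + e * x) -` A i))"
      using vi by (intro S.emeasure_PiM fin) auto
    also have "\<dots> = (\<Prod>i\<in>I. emeasure (density lborel (\<lambda>x. ennreal (normal_density (m i) e x))) (A i))"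
      using A by (intro prod.cong refl) (auto simp: emeasure_distr simp flip: distr_normal_affine[OF e])
    finally show "emeasure ?D (Pi\<^sub>E I A) = \<dots>" .
  qed
  also have "\<dots> = density (PiM I (\<lambda>_. lborel)) (\<lambda>c. \<Prod>i\<in>I. ennreal (normal_density (m i) e (c i)))"
    using prob by (intro PiM_density_lborel[symmetric] fin)
      (auto simp: prob_space_imp_sigma_finite)
  also have "\<dots> = density (PiM I (\<lambda>_. lborel)) (\<lambda>c. ennreal (\<Prod>i\<in>I. normal_density (m i) e (c i)))"
    by (simp add: prod_ennreal)
  finally show ?thesis .
qed

subsection \<open>Coordinates with respect to an orthonormal system\<close>

locale orthonormal_system =
  fixes B :: "'a::euclidean_space set"
  assumes orth: "pairwise orthogonal B" and unit: "\<And>b. b \<in> B \<Longrightarrow> norm b = 1"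
begin

text \<open>The parametrisation in \<open>affine_lebesgue\<close> with the base point left out. The
  vectors of \<open>B\<close> are their own indices, and values of c outside \<open>B\<close> are
  ignored.\<close>

definition emb :: "('a \<Rightarrow> real) \<Rightarrow> 'a" where
  "emb c = (\<Sum>b\<in>B. c b *\<^sub>R b)"

abbreviation L :: "('a \<Rightarrow> real) measure" where
  "L \<equiv> PiM B (\<lambda>_. lborel)"

lemma finite_B: "finite B"
  using orth by (rule pairwise_orthogonal_imp_finite)

lemma inner_B: "b \<in> B \<Longrightarrow> b' \<in> B \<Longrightarrow> b \<bullet> b' = (if b = b' then 1 else 0)"
  using orth unit by (auto simp: pairwise_def orthogonal_def norm_eq_1)

lemma emb_inner: 
  assumes "b \<in> B"
  shows "emb c \<bullet> b = c b"
proof -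
  have "emb c \<bullet> b = (\<Sum>b'\<in>B. if b' = b then c b' else 0)"
    unfolding emb_def inner_sum_left using assms by (intro sum.cong refl) (auto simp: inner_B)
  then show ?thesis using assms finite_B by simp
qed

lemma emb_cong: "(\<And>b. b \<in> B \<Longrightarrow> c b = c' b) \<Longrightarrow> emb c = emb c'"
  unfolding emb_def by (rule sum.cong) auto

lemma emb_span: "emb c \<in> span B"
  unfolding emb_def by (intro span_sum span_scale span_base)

lemma emb_add: "emb (\<lambda>b. c b + c' b) = emb c + emb c'"
  by (simp add: emb_def algebra_simps sum.distrib)

lemma emb_scale: "emb (\<lambda>b. r * c b) = r *\<^sub>R emb c"
  by (simp add: emb_def scaleR_sum_right)

lemma emb_coordinates:
  assumes "v \<in> span B"
  shows "emb (\<lambda>b. v \<bullet> b) = v"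
  using assms
proof (induction rule: span_induct_alt)
  case base
  then show ?case by (simp add: emb_def)
next
  case (step r b v)
  have "emb (\<lambda>b'. (r *\<^sub>R b + v) \<bullet> b') = r *\<^sub>R emb (\<lambda>b'. b \<bullet> b') + emb (\<lambda>b'. v \<bullet> b')"
    by (simp add: inner_add_left emb_add emb_scale)
  also have "emb (\<lambda>b'. b \<bullet> b') = (\<Sum>b'\<in>B. if b' = b then b' else 0)"
    unfolding emb_def using step by (intro sum.cong refl) (auto simp: inner_B)
  also have "\<dots> = b" using step finite_B by simp
  finally show ?case using step by simp
qed

lemma emb_inner_right: "v \<bullet> emb c = (\<Sum>b\<in>B. (v \<bullet> b) * c b)"
  by (simp add: emb_def inner_sum_right mult.commute)

lemma abs_le_norm_emb: "b \<in> B \<Longrightarrow> \<bar>c b\<bar> \<le> norm (emb c)"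
  using Cauchy_Schwarz_ineq2[of "emb c" b] by (simp add: emb_inner unit)

lemma measurable_emb[measurable]: "emb \<in> borel_measurable L"
  unfolding emb_def by measurable

lemma sigma_finite_L: "sigma_finite_measure L"
  using finite_B by (rule lborel_product.sigma_finite)

text \<open>The weight exp (- e^2 |emb c|^2 / 2), kept as a product so that integrals split into
  coordinates.\<close>

definition damping :: "real \<Rightarrow> ('a \<Rightarrow> real) \<Rightarrow> real" where
  "damping e c = (\<Prod>b\<in>B. exp (- (e\<^sup>2 * (c b)\<^sup>2) / 2))"

text \<open>On the span of \<open>B\<close> this is the centred Gaussian density with variance e^2
  in each direction; along the orthogonal complement it is constant.\<close>

definition kernel :: "real \<Rightarrow> 'a \<Rightarrow> real" where
  "kernel e v = (\<Prod>b\<in>B. normal_density 0 e (v \<bullet> b))"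

lemma measurable_damping[measurable]: "damping e \<in> borel_measurable L"
  unfolding damping_def by measurable

lemma measurable_kernel[measurable]: "kernel e \<in> borel_measurable borel"
  unfolding kernel_def by measurable

lemma kernel_nonneg: "0 \<le> kernel e v"
  unfolding kernel_def by (intro prod_nonneg) auto

lemma damping_nonneg: "0 \<le> damping e c"
  unfolding damping_def by (intro prod_nonneg) auto

lemma damping_le_1: "damping e c \<le> 1"
  unfolding damping_def by (intro prod_le_1) auto

lemma iexp_emb: "iexp (- (v \<bullet> emb c)) = (\<Prod>b\<in>B. iexp (- ((v \<bullet> b) * c b)))"
  by (simp add: emb_inner_right sum_distrib_left exp_sum finite_B flip: sum_negf)

lemma kernel_fourier:
  assumes e: "e > 0"
  shows "(CLINT c|L. iexp (- (v \<bullet> emb c)) * complex_of_real (damping e c)) =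
           complex_of_real ((2 * pi) ^ card B * kernel e v)"
proof -
  let ?f = "\<lambda>b s. iexp (- ((v \<bullet> b) * s)) * complex_of_real (exp (- (e\<^sup>2 * s\<^sup>2) / 2))"
  have "(CLINT c|L. iexp (- (v \<bullet> emb c)) * complex_of_real (damping e c))
     = (CLINT c|L. (\<Prod>b\<in>B. ?f b (c b)))"
    by (simp only: iexp_emb damping_def of_real_prod prod.distrib)
  also have "\<dots> = (\<Prod>b\<in>B. integral\<^sup>L lborel (?f b))"
    using normal_density_fourier[OF e] has_bochner_integral_iff
    by (intro lborel_product.product_integral_prod finite_B) blast
  also have "\<dots> = (\<Prod>b\<in>B. complex_of_real (2 * pi * normal_density 0 e (v \<bullet> b)))"
    using normal_density_fourier[OF e] by (intro prod.cong refl) (auto simp: has_bochner_integral_iff)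
  also have "\<dots> = complex_of_real ((2 * pi) ^ card B * kernel e v)"
    by (simp add: kernel_def prod.distrib)
  finally show ?thesis .
qed

lemma integrable_damping:
  assumes e: "e > 0"
  shows "integrable L (damping e)"
  unfolding damping_def
proof (intro lborel_product.product_integrable_prod finite_B)
  fix b assume "b \<in> B"
  \<comment> \<open>Frequency 0: the norm of this integrand is the weight itself.\<close>
  have "integrable lborel (\<lambda>s. iexp (- (0 * s)) * complex_of_real (exp (- (e\<^sup>2 * s\<^sup>2) / 2)))"
    using normal_density_fourier[OF e] has_bochner_integral_iff by blast
  from integrable_norm[OF this] show "integrable lborel (\<lambda>s. exp (- (e\<^sup>2 * s\<^sup>2) / 2))"
    by (simp only: norm_mult norm_of_real norm_exp_i_times abs_exp_cancel mult_1)
qed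

end

section \<open>Gaussian smoothing and the Fourier inversion integral\<close>

locale orthonormal_distribution = orthonormal_system B + prob_space F 
  for B :: "'a::euclidean_space set" and F :: "'a measure" +
  assumes sets_F[measurable_cong]: "sets F = sets borel"
begin

lemma measurable_cf_emb[measurable]: "(\<lambda>c. cf F (emb c)) \<in> borel_measurable L"
proof -
  have "cf F \<in> borel_measurable borel"
    by (intro borel_measurable_continuous_onI continuous_on_cf prob_space_axioms sets_F)
  then show ?thesis by measurable
qed

text \<open>If \<open>F\<close> is carried by a translate of the span of \<open>B\<close>, this is
  on that translate the density of X + e Z with Z standard normal in the coordinates; see
  \<open>smoothed_test\<close>.\<close>

definition smoothed :: "real \<Rightarrow> 'a \<Rightarrow> real" where
  "smoothed e x = (\<integral>y. kernel e (x - y) \<partial>F)"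

lemma smoothed_nonneg: "0 \<le> smoothed e x"
  unfolding smoothed_def by (intro integral_nonneg_AE) (simp add: kernel_nonneg)

lemma kernel_bounded:
  assumes "e > 0"
  shows "kernel e v \<le> (1 / e) ^ card B"
proof -
  have "normal_density 0 e u \<le> 1 / e" for u
  proof -
    have "1 \<le> sqrt (2 * pi)" using pi_gt3 by simp
    then have "e \<le> sqrt (2 * pi * e\<^sup>2)"
      using assms by (simp add: real_sqrt_mult[of "2 * pi"])
    then have "normal_density 0 e u \<le> 1 / sqrt (2 * pi * e\<^sup>2) * 1"
      unfolding normal_density_def by (intro mult_left_mono) auto
    also have "\<dots> \<le> 1 / e"
      using assms \<open>e \<le> _\<close> by (simp add: frac_le)
    finally show ?thesis .
  qed
  then have "kernel e v \<le> (\<Prod>b\<in>B. 1 / e)"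
    unfolding kernel_def by (intro prod_mono) auto
  then show ?thesis by simp
qed

lemma integrable_kernel:
  assumes "e > 0"
  shows "integrable F (\<lambda>y. kernel e (x - y))"
proof (rule integrable_const_bound[where B="(1 / e) ^ card B"])
  show "AE y in F. norm (kernel e (x - y)) \<le> (1 / e) ^ card B"
    using kernel_bounded[OF assms] by (simp add: kernel_nonneg)
qed measurable

text \<open>Inserting the Fourier integral of the kernel and exchanging integrals turns the average
  over \<open>F\<close> into its characteristic function. The damping factor provides the absolute
  integrability that Fubini asks for.\<close>

lemma smoothed_fourier:
  assumes e: "e > 0"
  shows "complex_of_real ((2 * pi) ^ card B * smoothed e x) =
    (CLINT c|L. (iexp (- (x \<bullet> emb c)) * cf F (emb c)) * complex_of_real (damping e c))"
proof -
  interpret L: sigma_finite_measure L by (rule sigma_finite_L)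
  interpret LF: pair_sigma_finite L F ..
  have m: "(\<lambda>(c, y). iexp (- ((x - y) \<bullet> emb c)) * complex_of_real (damping e c)) \<in> borel_measurable (L \<Otimes>\<^sub>M F)"
    by measurable
  have int: "integrable (L \<Otimes>\<^sub>M F) (\<lambda>(c, y). iexp (- ((x - y) \<bullet> emb c)) * complex_of_real (damping e c))"
  proof (rule Bochner_Integration.integrable_bound[OF _ m])
    show "integrable (L \<Otimes>\<^sub>M F) (\<lambda>(c, y). damping e c)"
    proof (rule LF.Fubini_integrable)
      show "(\<lambda>(c, y). damping e c) \<in> borel_measurable (L \<Otimes>\<^sub>M F)" by measurable
      show "integrable L (\<lambda>c. \<integral>y. norm (case (c, y) of (c, y) \<Rightarrow> damping e c) \<partial>F)"
        using integrable_damping[OF e] by (simp add: prob_space)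
    qed auto
  qed (auto simp: norm_mult damping_nonneg)
  have "complex_of_real ((2 * pi) ^ card B * smoothed e x) 
      = (CLINT y|F. complex_of_real ((2 * pi) ^ card B * kernel e (x - y)))"
    by (simp add: smoothed_def integral_complex_of_real)
  also have "\<dots> = (CLINT y|F. CLINT c|L. iexp (- ((x - y) \<bullet> emb c)) * complex_of_real (damping e c))"
    by (simp only: kernel_fourier[OF e])
  also have "\<dots> = (CLINT c|L. CLINT y|F. iexp (- ((x - y) \<bullet> emb c)) * complex_of_real (damping e c))"
    using int by (rule LF.Fubini_integral)
  also have "\<dots> = (CLINT c|L. (iexp (- (x \<bullet> emb c)) * cf F (emb c)) * complex_of_real (damping e c))"
  proof (rule Bochner_Integration.integral_cong[OF refl])
    fix c
    have "iexp (- ((x - y) \<bullet> emb c)) * complex_of_real (damping e c) =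
        (iexp (- (x \<bullet> emb c)) * complex_of_real (damping e c)) * iexp (emb c \<bullet> y)" for y
      by (simp add: inner_diff_left inner_commute algebra_simps flip: exp_add)
    then show "(CLINT y|F. iexp (- ((x - y) \<bullet> emb c)) * complex_of_real (damping e c)) =
      (iexp (- (x \<bullet> emb c)) * cf F (emb c)) * complex_of_real (damping e c)"
      by (simp only: integral_mult_right_zero cf_def) (simp only: mult_ac)
  qed
  finally show ?thesis .
qed

text \<open>The inversion integral over the frequencies in the span of \<open>B\<close> only. The
  real part makes it a real function outright; \<open>smoothed_tendsto\<close> exhibits it as a
  limit of densities.\<close>

definition inversion :: "'a \<Rightarrow> real" where
  "inversion x = Re (CLINT c|L. iexp (- (x \<bullet> emb c)) * cf F (emb c)) / (2 * pi) ^ card B"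

lemma damping_tendsto: "(\<lambda>n. damping (1 / Suc n) c) \<longlonglongrightarrow> 1"
proof -
  have "(\<lambda>n. damping (1 / Suc n) c) \<longlonglongrightarrow> (\<Prod>b\<in>B. exp (- (0\<^sup>2 * (c b)\<^sup>2) / 2))"
    unfolding damping_def
    by (intro tendsto_intros) (rule LIMSEQ_Suc[OF lim_1_over_n] | simp)+
  then show ?thesis by simp
qed

lemma smoothed_tendsto:
  assumes int: "integrable L (\<lambda>c. cf F (emb c))"
  shows "(\<lambda>n. smoothed (1 / Suc n) x) \<longlonglongrightarrow> inversion x"
proof -
  have "(\<lambda>n. CLINT c|L. (iexp (- (x \<bullet> emb c)) * cf F (emb c)) * complex_of_real (damping (1 / Suc n) c))
     \<longlonglongrightarrow> (CLINT c|L. iexp (- (x \<bullet> emb c)) * cf F (emb c))"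
  proof (rule integral_dominated_convergence[where w="\<lambda>c. cmod (cf F (emb c))"])
    show "AE c in L. (\<lambda>n. (iexp (- (x \<bullet> emb c)) * cf F (emb c)) * complex_of_real (damping (1 / Suc n) c)) 
        \<longlonglongrightarrow> iexp (- (x \<bullet> emb c)) * cf F (emb c)"
      using tendsto_mult[OF tendsto_const tendsto_of_real[OF damping_tendsto]] by auto
    show "AE c in L. norm ((iexp (- (x \<bullet> emb c)) * cf F (emb c)) * complex_of_real (damping (1 / Suc n) c))
        \<le> cmod (cf F (emb c))" for n
      by (simp add: norm_mult damping_nonneg damping_le_1 mult_left_le)
  qed (use int in \<open>measurable, auto\<close>)
  then have "(\<lambda>n. complex_of_real ((2 * pi) ^ card B * smoothed (1 / Suc n) x))
     \<longlonglongrightarrow> (CLINT c|L. iexp (- (x \<bullet> emb c)) * cf F (emb c))"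
    by (simp only: smoothed_fourier[of "1 / Suc _"] divide_pos_pos zero_less_one of_nat_0_less_iff zero_less_Suc)
  from tendsto_divide[OF tendsto_Re[OF this] tendsto_const[of "(2 * pi) ^ card B"]]
  show ?thesis by (simp add: inversion_def)
qed

text \<open>Positivity cannot be read off the oscillating integral; it is inherited from the
  smoothed densities.\<close>

lemma inversion_nonneg:
  assumes int: "integrable L (\<lambda>c. cf F (emb c))"
  shows "0 \<le> inversion x"
  using smoothed_tendsto[OF int] by (rule LIMSEQ_le_const) (auto simp: smoothed_nonneg)

text \<open>The bound is free of e, so it survives the limit in \<open>inversion_le\<close> and
  dominates the integrands in \<open>inversion_test\<close>.\<close>

lemma smoothed_le:
  assumes int: "integrable L (\<lambda>c. cf F (emb c))" and e: "e > 0"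
  shows "smoothed e x \<le> (\<integral>c. cmod (cf F (emb c)) \<partial>L) / (2 * pi) ^ card B"
proof -
  have "(2 * pi) ^ card B * smoothed e x = cmod (complex_of_real ((2 * pi) ^ card B * smoothed e x))"
    unfolding norm_of_real using smoothed_nonneg[of e x] by (simp add: abs_mult)
  also have "\<dots> \<le> (\<integral>c. cmod (iexp (- (x \<bullet> emb c)) * cf F (emb c) * complex_of_real (damping e c)) \<partial>L)"
    unfolding smoothed_fourier[OF e] by (rule integral_norm_bound)
  also have "\<dots> \<le> (\<integral>c. cmod (cf F (emb c)) \<partial>L)"
    using int by (intro integral_mono_AE')
      (auto simp: norm_mult damping_nonneg damping_le_1 mult_left_le)
  finally show ?thesis by (simp add: pos_le_divide_eq mult.commute)
qed

lemma inversion_le: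
  assumes int: "integrable L (\<lambda>c. cf F (emb c))"
  shows "inversion x \<le> (\<integral>c. cmod (cf F (emb c)) \<partial>L) / (2 * pi) ^ card B"
  using smoothed_tendsto[OF int] by (rule LIMSEQ_le_const2) (intro exI allI impI smoothed_le[OF int]; simp)

lemma continuous_on_inversion:
  assumes int: "integrable L (\<lambda>c. cf F (emb c))"
  shows "continuous_on A inversion"
proof (rule continuous_on_sequentiallyI)
  fix u :: "nat \<Rightarrow> 'a" and a assume u: "u \<longlonglongrightarrow> a"
  have "(\<lambda>n. CLINT c|L. iexp (- (u n \<bullet> emb c)) * cf F (emb c))
     \<longlonglongrightarrow> (CLINT c|L. iexp (- (a \<bullet> emb c)) * cf F (emb c))"
  proof (rule integral_dominated_convergence[where w="\<lambda>c. cmod (cf F (emb c))"])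
    show "AE c in L. (\<lambda>n. iexp (- (u n \<bullet> emb c)) * cf F (emb c)) \<longlonglongrightarrow> iexp (- (a \<bullet> emb c)) * cf F (emb c)"
      using u by (auto intro!: tendsto_intros)
  qed (use int in \<open>measurable, auto simp: norm_mult\<close>)
  then show "(\<lambda>n. inversion (u n)) \<longlonglongrightarrow> inversion a"
    unfolding inversion_def by (intro tendsto_intros) auto
qed

end

section \<open>The inversion integral as a density\<close>

context orthonormal_distribution
begin

text \<open>Relative to the base point a, the point y + e emb z has the coordinates (y - a) . b + e
  z b; this is where y has to lie on the translate. Hence its law is a product of normal laws with
  these centres.\<close>

lemma nn_integral_gauss_shift:
  assumes y: "y - a \<in> span B" and e: "e > 0" and [measurable]: "f \<in> borel_measurable borel"
  shows "(\<integral>\<^sup>+z. f (y + e *\<^sub>R emb z) \<partial>PiM B (\<lambda>_. std_normal_distribution))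
    = (\<integral>\<^sup>+c. ennreal (kernel e (a + emb c - y)) * f (a + emb c) \<partial>L)"
proof -
  let ?m = "\<lambda>b. (y - a) \<bullet> b"
  let ?N = "PiM B (\<lambda>_. std_normal_distribution)"
  have [measurable_cong]: "sets ?N = sets L"
    by (auto intro!: sets_PiM_cong)
  have [measurable]: "(\<lambda>z. \<lambda>b\<in>B. ?m b + e * z b) \<in> L \<rightarrow>\<^sub>M L" by measurable
  have emb_y: "a + emb (\<lambda>b\<in>B. ?m b + e * z b) = y + e *\<^sub>R emb z" for z
  proof -
    have "emb (\<lambda>b\<in>B. ?m b + e * z b) = emb (\<lambda>b. ?m b + e * z b)"
      by (rule emb_cong) simp
    then show ?thesis
      using emb_coordinates[OF y] by (simp add: emb_add emb_scale)
  qed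
  have k: "kernel e (a + emb c - y) = (\<Prod>b\<in>B. normal_density (?m b) e (c b))" for c
    unfolding kernel_def
    by (intro prod.cong refl) (simp add: normal_density_def inner_add_left inner_diff_left emb_inner algebra_simps)
  have "(\<integral>\<^sup>+z. f (y + e *\<^sub>R emb z) \<partial>?N) = (\<integral>\<^sup>+z. f (a + emb (\<lambda>b\<in>B. ?m b + e * z b)) \<partial>?N)"
    by (simp only: emb_y)
  also have "\<dots> = (\<integral>\<^sup>+c. f (a + emb c) \<partial>distr ?N L (\<lambda>z. \<lambda>b\<in>B. ?m b + e * z b))"
    by (rule nn_integral_distr[symmetric]) measurable
  also have "\<dots> = (\<integral>\<^sup>+c. ennreal (\<Prod>b\<in>B. normal_density (?m b) e (c b)) * f (a + emb c) \<partial>L)"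
    unfolding distr_PiM_normal_affine[OF finite_B e] by (rule nn_integral_density) measurable
  finally show ?thesis by (simp only: k)
qed

text \<open>Both sides are the expectation of f at X + e Z, computed once by conditioning on X and
  once through the smoothed density.\<close>

lemma smoothed_test:
  assumes supp: "AE y in F. y - a \<in> span B" and e: "e > 0" and [measurable]: "f \<in> borel_measurable borel"
  shows "(\<integral>\<^sup>+y. \<integral>\<^sup>+z. f (y + e *\<^sub>R emb z) \<partial>PiM B (\<lambda>_. std_normal_distribution) \<partial>F)
    = (\<integral>\<^sup>+c. ennreal (smoothed e (a + emb c)) * f (a + emb c) \<partial>L)"
proof -
  interpret L: sigma_finite_measure L by (rule sigma_finite_L)
  interpret LF: pair_sigma_finite L F ..
  have "(\<integral>\<^sup>+y. \<integral>\<^sup>+z. f (y + e *\<^sub>R emb z) \<partial>PiM B (\<lambda>_. std_normal_distribution) \<partial>F)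
     = (\<integral>\<^sup>+y. \<integral>\<^sup>+c. ennreal (kernel e (a + emb c - y)) * f (a + emb c) \<partial>L \<partial>F)"
    using supp by (intro nn_integral_cong_AE) (auto simp: nn_integral_gauss_shift[OF _ e])
  also have "\<dots> = (\<integral>\<^sup>+c. \<integral>\<^sup>+y. ennreal (kernel e (a + emb c - y)) * f (a + emb c) \<partial>F \<partial>L)"
    by (rule LF.Fubini') measurable
  also have "\<dots> = (\<integral>\<^sup>+c. (\<integral>\<^sup>+y. ennreal (kernel e (a + emb c - y)) \<partial>F) * f (a + emb c) \<partial>L)"
    by (intro nn_integral_cong nn_integral_multc) measurable
  also have "\<dots> = (\<integral>\<^sup>+c. ennreal (smoothed e (a + emb c)) * f (a + emb c) \<partial>L)"
    unfolding smoothed_def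
    by (subst nn_integral_eq_integral) (auto simp: integrable_kernel[OF e] kernel_nonneg)
  finally show ?thesis .
qed

lemma emeasure_emb_bounded:
  assumes "bounded U"
  shows "emeasure L {c \<in> space L. a + emb c \<in> U} < \<infinity>"
proof -
  obtain R where R: "\<And>x. x \<in> U \<Longrightarrow> norm x \<le> R"
    using assms by (auto simp: bounded_iff)
  let ?P = "Pi\<^sub>E B (\<lambda>_. {- (R + norm a)..R + norm a})"
  have P: "?P \<in> sets L" by (intro sets_PiM_I_finite finite_B) auto
  have "{c \<in> space L. a + emb c \<in> U} \<subseteq> ?P"
  proof
    fix c assume c: "c \<in> {c \<in> space L. a + emb c \<in> U}"
    have "norm (emb c) \<le> R + norm a"
      using R[of "a + emb c"] c norm_triangle_ineq4[of "a + emb c" a] by auto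
    then have "c b \<in> {- (R + norm a)..R + norm a}" if "b \<in> B" for b
      using abs_le_norm_emb[OF that, of c] unfolding atLeastAtMost_iff by linarith
    moreover have "c \<in> extensional B" using c by (simp add: space_PiM PiE_iff)
    ultimately show "c \<in> ?P" unfolding PiE_iff by blast
  qed
  then have "emeasure L {c \<in> space L. a + emb c \<in> U} \<le> emeasure L ?P"
    using P by (rule emeasure_mono)
  also have "\<dots> = (\<Prod>b\<in>B. emeasure lborel {- (R + norm a)..R + norm a})"
    by (rule lborel_product.emeasure_PiM[OF finite_B]) auto
  also have "\<dots> < \<infinity>"
    by (simp add: emeasure_lborel_Icc_eq power_less_top_ennreal)
  finally show ?thesis .
qed

text \<open>The limit e = 1 / Suc n -> 0 in \<open>smoothed_test\<close>. As \<open>L\<close> is in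
  general infinite, the constant bound from \<open>smoothed_le\<close> dominates only after
  restriction to the bounded set outside which f vanishes.\<close>

lemma inversion_test:
  fixes f :: "'a \<Rightarrow> real"
  assumes supp: "AE y in F. y - a \<in> span B"
    and int: "integrable L (\<lambda>c. cf F (emb c))"
    and cont: "continuous_on UNIV f" and f01: "\<And>x. 0 \<le> f x" "\<And>x. f x \<le> 1"
    and U: "bounded U" "open U" and f0: "\<And>x. x \<notin> U \<Longrightarrow> f x = 0"
  shows "(\<integral>\<^sup>+y. f y \<partial>F) = (\<integral>\<^sup>+c. ennreal (inversion (a + emb c)) * f (a + emb c) \<partial>L)"
proof -
  let ?N = "PiM B (\<lambda>_. std_normal_distribution)"
  interpret N: prob_space ?N
    by (intro prob_space_PiM prob_space_normal_density) simp
  have [measurable_cong]: "sets ?N = sets L"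
    by (auto intro!: sets_PiM_cong)
  have [measurable]: "f \<in> borel_measurable borel"
    using cont by (rule borel_measurable_continuous_onI)
  have [measurable]: "U \<in> sets borel" using U by simp
  have [measurable]: "inversion \<in> borel_measurable borel"
    by (intro borel_measurable_continuous_onI continuous_on_inversion int)
  have [measurable]: "smoothed e \<in> borel_measurable borel" for e
    unfolding smoothed_def by measurable
  have fconv: "(\<lambda>n. f (u n)) \<longlonglongrightarrow> f x" if "u \<longlonglongrightarrow> x" for u x
    using continuous_on_tendsto_compose[OF cont that] by simp
  define C where "C = (\<integral>c. cmod (cf F (emb c)) \<partial>L) / (2 * pi) ^ card B"
  have inner: "(\<lambda>n. \<integral>\<^sup>+z. f (y + (1 / Suc n) *\<^sub>R emb z) \<partial>?N) \<longlonglongrightarrow> ennreal (f y)" for y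
  proof -
    have "(\<lambda>n. \<integral>\<^sup>+z. f (y + (1 / Suc n) *\<^sub>R emb z) \<partial>?N) \<longlonglongrightarrow> (\<integral>\<^sup>+z. f y \<partial>?N)"
    proof (rule nn_integral_dominated_convergence[where w="\<lambda>_. 1"])
      have "(\<lambda>n. y + (1 / Suc n) *\<^sub>R emb z) \<longlonglongrightarrow> y + 0 *\<^sub>R emb z" for z
        by (intro tendsto_intros) (rule LIMSEQ_Suc[OF lim_1_over_n])
      then show "AE z in ?N. (\<lambda>n. ennreal (f (y + (1 / Suc n) *\<^sub>R emb z))) \<longlonglongrightarrow> ennreal (f y)"
        by (intro AE_I2 tendsto_ennrealI fconv) simp
    qed (auto simp: N.emeasure_space_1 f01 ennreal_le_1)
    then show ?thesis by (simp add: N.emeasure_space_1)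
  qed
  have "(\<lambda>n. \<integral>\<^sup>+y. \<integral>\<^sup>+z. f (y + (1 / Suc n) *\<^sub>R emb z) \<partial>?N \<partial>F) \<longlonglongrightarrow> (\<integral>\<^sup>+y. f y \<partial>F)"
  proof (rule nn_integral_dominated_convergence[where w="\<lambda>_. 1"])
    show "AE y in F. (\<integral>\<^sup>+z. f (y + (1 / Suc n) *\<^sub>R emb z) \<partial>?N) \<le> 1" for n
    proof (rule AE_I2)
      fix y
      have "(\<integral>\<^sup>+z. f (y + (1 / Suc n) *\<^sub>R emb z) \<partial>?N) \<le> (\<integral>\<^sup>+z. 1 \<partial>?N)"
        by (intro nn_integral_mono) (simp add: f01 ennreal_le_1)
      then show "(\<integral>\<^sup>+z. f (y + (1 / Suc n) *\<^sub>R emb z) \<partial>?N) \<le> 1"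
        by (simp add: N.emeasure_space_1)
    qed
  qed (use inner in \<open>auto simp: emeasure_space_1\<close>)
  then have "(\<lambda>n. \<integral>\<^sup>+c. ennreal (smoothed (1 / Suc n) (a + emb c)) * f (a + emb c) \<partial>L) \<longlonglongrightarrow> (\<integral>\<^sup>+y. f y \<partial>F)"
    by (subst (asm) smoothed_test[OF supp]) auto
  moreover have "(\<lambda>n. \<integral>\<^sup>+c. ennreal (smoothed (1 / Suc n) (a + emb c)) * f (a + emb c) \<partial>L) \<longlonglongrightarrow> 
     (\<integral>\<^sup>+c. ennreal (inversion (a + emb c)) * f (a + emb c) \<partial>L)"
  proof (rule nn_integral_dominated_convergence[where w="\<lambda>c. ennreal C * indicator {c \<in> space L. a + emb c \<in> U} c"])
    show "AE c in L. ennreal (smoothed (1 / Suc n) (a + emb c)) * f (a + emb c)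
        \<le> ennreal C * indicator {c \<in> space L. a + emb c \<in> U} c" for n
    proof (rule AE_I2)
      fix c assume c: "c \<in> space L"
      show "ennreal (smoothed (1 / Suc n) (a + emb c)) * f (a + emb c)
        \<le> ennreal C * indicator {c \<in> space L. a + emb c \<in> U} c"
      proof (cases "a + emb c \<in> U")
        case True
        have "ennreal (smoothed (1 / Suc n) (a + emb c)) * f (a + emb c) \<le> ennreal C * 1"
          unfolding C_def using f01(2) 
          by (intro mult_mono ennreal_leI smoothed_le[OF int]) (auto simp: ennreal_le_1)
        then show ?thesis using True c by simp
      qed (simp add: f0)
    qed
    show "(\<integral>\<^sup>+c. ennreal C * indicator {c \<in> space L. a + emb c \<in> U} c \<partial>L) < \<infinity>"
      using emeasure_emb_bounded[OF U(1)] by (subst nn_integral_cmult_indicator) (auto simp: ennreal_mult_less_top)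
    show "AE c in L. (\<lambda>n. ennreal (smoothed (1 / Suc n) (a + emb c)) * ennreal (f (a + emb c)))
        \<longlonglongrightarrow> ennreal (inversion (a + emb c)) * ennreal (f (a + emb c))"
    proof (rule AE_I2)
      fix c
      have "(\<lambda>n. ennreal (smoothed (1 / Suc n) (a + emb c) * f (a + emb c)))
        \<longlonglongrightarrow> ennreal (inversion (a + emb c) * f (a + emb c))"
        by (intro tendsto_ennrealI tendsto_intros smoothed_tendsto[OF int])
      then show "(\<lambda>n. ennreal (smoothed (1 / Suc n) (a + emb c)) * ennreal (f (a + emb c)))
        \<longlonglongrightarrow> ennreal (inversion (a + emb c)) * ennreal (f (a + emb c))"
        by (simp add: ennreal_mult smoothed_nonneg inversion_nonneg[OF int] f01)
    qed
  qed auto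
  ultimately show ?thesis by (rule LIMSEQ_unique)
qed

lemma emeasure_open_bounded:
  assumes supp: "AE y in F. y - a \<in> span B"
    and int: "integrable L (\<lambda>c. cf F (emb c))"
    and U: "bounded U" "open U"
  shows "emeasure F U = (\<integral>\<^sup>+c. ennreal (inversion (a + emb c)) * indicator U (a + emb c) \<partial>L)"
proof -
  have [measurable]: "U \<in> sets borel" using U by simp
  have [measurable]: "inversion \<in> borel_measurable borel"
    by (intro borel_measurable_continuous_onI continuous_on_inversion int)
  \<comment> \<open>The distance \<open>infdist\<close> to the empty set is 0 by convention, which
    would make all the functions f n below vanish.\<close>
  have "- U \<noteq> {}"
  proof
    assume "- U = {}"
    then have "U = UNIV" by blast
    then show False using U(1) not_bounded_UNIV by simp
  qed
  \<comment> \<open>Continuous functions that increase to the indicator of the open set U.\<close>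
  define f where "f n x = min 1 (real n * infdist x (- U))" for n x
  have f: "continuous_on UNIV (f n)" "\<And>x. 0 \<le> f n x" "\<And>x. f n x \<le> 1" "\<And>x. x \<notin> U \<Longrightarrow> f n x = 0" for n
    unfolding f_def by (auto intro!: continuous_intros infdist_nonneg mult_nonneg_nonneg)
  have [measurable]: "f n \<in> borel_measurable borel" for n
    using f(1) by (rule borel_measurable_continuous_onI)
  have mono: "incseq f"
    unfolding f_def incseq_def le_fun_def
    by (intro allI impI min.mono order_refl mult_right_mono infdist_nonneg) simp
  have lim: "(\<lambda>n. f n x) \<longlonglongrightarrow> indicator U x" for x
  proof (cases "x \<in> U")
    case True
    have "infdist x (- U) > 0"
      using U True \<open>- U \<noteq> {}\<close> by (simp add: infdist_pos_not_in_closed closed_Compl)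
    then obtain N :: nat where N: "1 / infdist x (- U) < N" using reals_Archimedean2 by blast
    have "f n x = 1" if "n \<ge> N" for n
    proof -
      have "1 / infdist x (- U) < n" using N that by linarith
      then show ?thesis using \<open>infdist x (- U) > 0\<close> by (simp add: f_def field_simps)
    qed
    then have "eventually (\<lambda>n. f n x = 1) sequentially"
      by (auto simp: eventually_sequentially)
    then show ?thesis using True by (simp add: tendsto_eventually)
  next
    case False
    then show ?thesis using f(4) by simp
  qed
  have "(\<lambda>n. \<integral>\<^sup>+y. f n y \<partial>F) \<longlonglongrightarrow> (\<integral>\<^sup>+y. ennreal (indicator U y) \<partial>F)"
    using mono lim by (intro nn_integral_LIMSEQ)
      (auto simp: incseq_def le_fun_def intro!: ennreal_leI tendsto_ennrealI)
  moreover have "(\<lambda>n. \<integral>\<^sup>+c. ennreal (inversion (a + emb c)) * f n (a + emb c) \<partial>L) \<longlonglongrightarrow> 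
     (\<integral>\<^sup>+c. ennreal (inversion (a + emb c)) * ennreal (indicator U (a + emb c)) \<partial>L)"
  proof (rule nn_integral_LIMSEQ)
    show "incseq (\<lambda>n c. ennreal (inversion (a + emb c)) * ennreal (f n (a + emb c)))"
      using mono by (auto simp: incseq_def le_fun_def intro!: mult_left_mono ennreal_leI)
    show "(\<lambda>n. ennreal (inversion (a + emb c)) * ennreal (f n (a + emb c))) \<longlonglongrightarrow> 
      ennreal (inversion (a + emb c)) * ennreal (indicator U (a + emb c))" for c
    proof -
      have "(\<lambda>n. ennreal (inversion (a + emb c) * f n (a + emb c))) \<longlonglongrightarrow> 
        ennreal (inversion (a + emb c) * indicator U (a + emb c))"
        by (intro tendsto_ennrealI tendsto_intros lim)
      then show ?thesis
        by (simp add: ennreal_mult inversion_nonneg[OF int] f)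
    qed
  qed auto
  moreover have "(\<integral>\<^sup>+y. f n y \<partial>F) = (\<integral>\<^sup>+c. ennreal (inversion (a + emb c)) * f n (a + emb c) \<partial>L)" for n
    using U f by (intro inversion_test supp int) auto
  ultimately have "(\<integral>\<^sup>+y. ennreal (indicator U y) \<partial>F) =
      (\<integral>\<^sup>+c. ennreal (inversion (a + emb c)) * ennreal (indicator U (a + emb c)) \<partial>L)"
    using LIMSEQ_unique by auto
  then show ?thesis by (simp add: ennreal_indicator nn_integral_indicator)
qed

text \<open>Open boxes are bounded, closed under intersection, exhaust the space and generate the
  Borel sets, so agreement on bounded open sets suffices.\<close>

lemma eq_density_inversion:
  assumes supp: "AE y in F. y - a \<in> span B"
    and int: "integrable L (\<lambda>c. cf F (emb c))"
    and S: "S = {a + v | v. v \<in> span B}"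
  shows "F = density (distr L borel (\<lambda>c. a + emb c)) (\<lambda>x. ennreal (inversion x) * indicator S x)"
    (is "F = ?D")
proof (rule measure_eqI_generator_eq[where E="range (\<lambda>(a, b). box a b)" and A="\<lambda>n. box (- (real n *\<^sub>R One)) (real n *\<^sub>R One)" and \<Omega>=UNIV])
  have [measurable]: "inversion \<in> borel_measurable borel"
    by (intro borel_measurable_continuous_onI continuous_on_inversion int)
  have "closed ((+) a ` span B)" by (intro closed_translation closed_span)
  moreover have "(+) a ` span B = S" by (auto simp: S)
  ultimately have [measurable]: "S \<in> sets borel" by auto
  show "Int_stable (range (\<lambda>(a, b). box a b :: 'a set))"
    by (auto simp: Int_stable_def box_Int_box)
  show "emeasure F X = emeasure ?D X" if "X \<in> range (\<lambda>(a, b). box a b)" for X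
  proof -
    have X: "bounded X" "open X" using that by (auto simp: bounded_box open_box)
    then have [measurable]: "X \<in> sets borel" by simp
    have "emeasure ?D X = (\<integral>\<^sup>+x. ennreal (inversion x) * indicator S x * indicator X x \<partial>distr L borel (\<lambda>c. a + emb c))"
      by (rule emeasure_density) auto
    also have "\<dots> = (\<integral>\<^sup>+c. ennreal (inversion (a + emb c)) * indicator S (a + emb c) * indicator X (a + emb c) \<partial>L)"
      by (rule nn_integral_distr) auto
    also have "\<dots> = (\<integral>\<^sup>+c. ennreal (inversion (a + emb c)) * indicator X (a + emb c) \<partial>L)"
      using emb_span by (intro nn_integral_cong) (auto simp: S)
    finally show ?thesis using emeasure_open_bounded[OF supp int X] by simp
  qed
  show "sets F = sigma_sets UNIV (range (\<lambda>(a, b). box a b))"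
    by (simp add: sets_F borel_eq_box)
  show "sets ?D = sigma_sets UNIV (range (\<lambda>(a, b). box a b))"
    by (simp add: borel_eq_box)
  show "(\<Union>n. box (- (real n *\<^sub>R One)) (real n *\<^sub>R One)) = (UNIV :: 'a set)"
    by (rule UN_box_eq_UNIV)
qed (auto simp: emeasure_eq_measure)

end

section \<open>From polynomial decay to a density on an affine subspace\<close>

lemma integrable_inverse_1_plus_square: "integrable lborel (\<lambda>x::real. 1 / (1 + x\<^sup>2))"
proof -
  let ?g = "\<lambda>x::real. indicator {0<..} x *\<^sub>R (1 / (1 + x\<^sup>2))"
  have pos: "integrable lborel ?g"
    using integrable_I0i_1_div_plus_square
    by (simp add: interval_lebesgue_integrable_def einterval_eq_Ici zero_ereal_def set_integrable_def)
  have "integrable lborel (\<lambda>x. ?g (0 + (- 1) * x))"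
    using pos by (rule lborel_integrable_real_affine) simp
  with pos have "integrable lborel (\<lambda>x. ?g x + ?g (0 + (- 1) * x))"
    by (rule Bochner_Integration.integrable_add)
  then show ?thesis
  proof (rule integrable_cong_AE_imp)
    have "AE x in lborel. x \<noteq> (0::real)" by (rule AE_lborel_singleton)
    then show "AE x in lborel. ?g x + ?g (0 + (- 1) * x) = 1 / (1 + x\<^sup>2)"
      by eventually_elim (auto split: split_indicator)
  qed measurable
qed

text \<open>Each factor 1 + (c b)^2 is at most 1 + |emb c|^2, so decay of order
  \<open>card B\<close> leaves a product of integrable functions of one coordinate each as a
  majorant.\<close>

lemma (in orthonormal_distribution) integrable_cf_emb:
  assumes C: "\<And>v. v \<in> span B \<Longrightarrow> cmod (cf F v) * (1 + (norm v)\<^sup>2) ^ card B \<le> C"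
  shows "integrable L (\<lambda>c. cf F (emb c))"
proof (rule Bochner_Integration.integrable_bound)
  show "integrable L (\<lambda>c. C * (\<Prod>b\<in>B. 1 / (1 + (c b)\<^sup>2)))"
    by (intro integrable_mult_right lborel_product.product_integrable_prod finite_B
        integrable_inverse_1_plus_square)
  show "AE c in L. norm (cf F (emb c)) \<le> norm (C * (\<Prod>b\<in>B. 1 / (1 + (c b)\<^sup>2)))"
  proof (rule AE_I2)
    fix c :: "'a \<Rightarrow> real"
    let ?P = "\<Prod>b\<in>B. 1 + (c b)\<^sup>2"
    have "?P \<le> (\<Prod>b\<in>B. 1 + (norm (emb c))\<^sup>2)"
      using abs_le_norm_emb by (intro prod_mono) (auto simp: abs_le_square_iff[symmetric])
    then have "cmod (cf F (emb c)) * ?P \<le> cmod (cf F (emb c)) * (1 + (norm (emb c))\<^sup>2) ^ card B"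
      by (intro mult_left_mono) auto
    also have "\<dots> \<le> C" using emb_span by (rule C)
    finally have "cmod (cf F (emb c)) * ?P \<le> C" .
    moreover have "?P > 0" by (intro prod_pos) (auto intro: add_pos_nonneg)
    ultimately have "cmod (cf F (emb c)) \<le> C / ?P" by (simp add: pos_le_divide_eq)
    also have "\<dots> \<le> \<bar>C / ?P\<bar>" by (rule abs_ge_self)
    finally show "norm (cf F (emb c)) \<le> norm (C * (\<Prod>b\<in>B. 1 / (1 + (c b)\<^sup>2)))"
      by (simp add: prod_dividef)
  qed
qed measurable

text \<open>Gives access to the frame picked by the choice operator in
  \<open>affine_lebesgue\<close>, so that inversion takes place in exactly the coordinates that
  define the Lebesgue measure.\<close>

lemma orthonormal_frame_SOME:
  fixes S :: "'a::euclidean_space set"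
  assumes "affine S" "S \<noteq> {}"
  obtains a B where "(SOME (a, B). orthonormal_frame S a B) = (a, B)" "orthonormal_frame S a B"
proof -
  have "\<exists>p. case p of (a, B) \<Rightarrow> orthonormal_frame S a B"
    using orthonormal_frame_exists[OF assms] by auto
  define p where "p = (SOME (a, B). orthonormal_frame S a B)"
  have "case p of (a, B) \<Rightarrow> orthonormal_frame S a B"
    unfolding p_def by (rule someI_ex) fact
  then have "orthonormal_frame S (fst p) (snd p)" by (simp add: split_beta)
  moreover have "(SOME (a, B). orthonormal_frame S a B) = (fst p, snd p)"
    unfolding p_def by (rule surjective_pairing)
  ultimately show ?thesis by (rule that[rotated])
qed

text \<open>The differences x - y run through the direction space of S, and all exponents k are
  allowed because the dimension \<open>card B\<close> appears only with the frame. Thus the decay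
  hypothesis can be stated without coordinates.\<close>

lemma has_bounded_continuous_density_on_affine:
  fixes S :: "'a::euclidean_space set"
  assumes F: "prob_space F" "sets F = sets borel"
    and S: "affine S" "S \<noteq> {}" and supp: "AE x in F. x \<in> S"
    and decay: "\<And>k. \<exists>C. \<forall>x\<in>S. \<forall>y\<in>S. cmod (cf F (x - y)) * (1 + (norm (x - y))\<^sup>2) ^ k \<le> C"
  shows "has_bounded_continuous_density_on F S"
proof -
  obtain a B where aB: "(SOME (a, B). orthonormal_frame S a B) = (a, B)" "orthonormal_frame S a B"
    using orthonormal_frame_SOME[OF S] .
  then have S_eq: "S = {a + v | v. v \<in> span B}" and a: "a \<in> S"
    by (auto simp: orthonormal_frame_def)
  interpret prob_space F by fact
  interpret orthonormal_distribution B F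
    using aB(2) F by unfold_locales (auto simp: orthonormal_frame_def)
  obtain C where C: "\<And>x y. x \<in> S \<Longrightarrow> y \<in> S \<Longrightarrow> cmod (cf F (x - y)) * (1 + (norm (x - y))\<^sup>2) ^ card B \<le> C"
    using decay[of "card B"] by blast
  have int: "integrable L (\<lambda>c. cf F (emb c))"
  proof (rule integrable_cf_emb)
    fix v assume "v \<in> span B"
    then show "cmod (cf F v) * (1 + (norm v)\<^sup>2) ^ card B \<le> C"
      using C[of "a + v" a] a S_eq by auto
  qed
  have "AE y in F. y - a \<in> span B"
    using supp by eventually_elim (auto simp: S_eq)
  from eq_density_inversion[OF this int S_eq]
  have "F = density (affine_lebesgue S) (\<lambda>x. ennreal (inversion x) * indicator S x)"
    by (simp add: affine_lebesgue_def aB(1) emb_def[abs_def])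
  moreover have "bounded (inversion ` S)"
    unfolding bounded_iff using inversion_le[OF int] inversion_nonneg[OF int] by auto
  ultimately show ?thesis
    unfolding has_bounded_continuous_density_on_def
    using continuous_on_inversion[OF int] inversion_nonneg[OF int] by blast
qed

subsection \<open>Decay of self-similar characteristic functions\<close>

text \<open>Successive terms have the ratio q ^ (2 ^ j) * R, which eventually stays below 1; from
  there on the terms decrease, and the sum of the earlier ones bounds everything.\<close>

lemma double_exponential_bounded:
  fixes q R :: real
  assumes q: "0 \<le> q" "q < 1" and R: "0 \<le> R"
  shows "\<exists>C. \<forall>j. q ^ (2 ^ j) * R ^ j \<le> C"
proof -
  define u where "u j = q ^ (2 ^ j) * R ^ j" for j :: nat
  have "(\<lambda>j. q ^ (2 ^ j)) \<longlonglongrightarrow> 0"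
    using LIMSEQ_subseq_LIMSEQ[OF LIMSEQ_realpow_zero[OF q], of "\<lambda>j. 2 ^ j"]
    by (simp add: strict_mono_def comp_def)
  then have "(\<lambda>j. q ^ (2 ^ j) * R) \<longlonglongrightarrow> 0 * R"
    by (intro tendsto_intros)
  then have "eventually (\<lambda>j. q ^ (2 ^ j) * R < 1) sequentially"
    by (rule order_tendstoD) simp
  then obtain J where J: "\<And>j. j \<ge> J \<Longrightarrow> q ^ (2 ^ j) * R < 1"
    by (auto simp: eventually_sequentially)
  have nonneg: "0 \<le> u j" for j unfolding u_def using q R by simp
  have "u (Suc j) \<le> u j" if "j \<ge> J" for j
  proof -
    have "u (Suc j) = u j * (q ^ (2 ^ j) * R)"
      by (simp add: u_def power_mult power2_eq_square algebra_simps mult_2 power_add)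
    also have "\<dots> \<le> u j * 1"
      using J[OF that] nonneg by (intro mult_left_mono) auto
    finally show ?thesis by simp
  qed
  note dec = this
  have tail: "u j \<le> u J" if "j \<ge> J" for j
    using that
  proof (induction j rule: dec_induct)
    case (step i)
    then show ?case using dec[of i] by linarith
  qed simp
  have "u j \<le> (\<Sum>i\<le>J. u i)" for j
  proof (cases "j \<le> J")
    case True
    then show ?thesis using nonneg by (intro member_le_sum) auto
  next
    case False
    have "u J \<le> (\<Sum>i\<le>J. u i)" using nonneg by (intro member_le_sum) auto
    then show ?thesis using tail[of j] False by linarith
  qed
  then show ?thesis unfolding u_def by blast
qed

lemma power_interval:
  fixes x b :: real
  assumes "1 < b" "1 \<le> x"
  obtains j where "b ^ j \<le> x" "x < b ^ Suc j"
proof -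
  define n where "n = (LEAST n. x < b ^ n)"
  have n: "x < b ^ n"
    unfolding n_def using real_arch_pow[OF assms(1)] by (auto intro: LeastI_ex)
  then obtain j where j: "n = Suc j" using assms(2) by (cases n) auto
  then have "\<not> x < b ^ j" using not_less_Least[of j "\<lambda>n. x < b ^ n"] by (auto simp: n_def)
  then show ?thesis using n j that[of j] by (simp add: not_less)
qed

lemma self_similar_cf_power:
  fixes F :: "'a::euclidean_space measure"
  assumes sim: "\<And>s. cmod (cf F (b *\<^sub>R s)) = (cmod (cf F s))\<^sup>2"
  shows "cmod (cf F (b ^ j *\<^sub>R v)) = (cmod (cf F v)) ^ (2 ^ j)"
proof (induction j)
  case (Suc j)
  then show ?case using sim[of "b ^ j *\<^sub>R v"] by (simp add: power_mult[symmetric] mult.commute)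
qed simp

text \<open>Writing v = b^j w with w in the shell gives |phi v| <= q^(2^j), while the weight grows
  only like b^(2 k j). Inside the unit ball the weight is at most 2^k.\<close>

lemma self_similar_cf_decay:
  fixes F :: "'a::euclidean_space measure"
  assumes F: "prob_space F" "sets F = sets borel"
    and b: "b > 1" and sim: "\<And>s. cmod (cf F (b *\<^sub>R s)) = (cmod (cf F s))\<^sup>2"
    and D: "subspace D" and less: "\<And>v. v \<in> D \<Longrightarrow> v \<noteq> 0 \<Longrightarrow> cmod (cf F v) < 1"
  shows "\<exists>C. \<forall>v\<in>D. cmod (cf F v) * (1 + (norm v)\<^sup>2) ^ k \<le> C"
proof -
  let ?A = "{v \<in> D. 1 \<le> norm v \<and> norm v \<le> b}"
  have "compact ?A"
  proof -
    have "?A = D \<inter> (cball 0 b - ball 0 1)" by auto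
    then show ?thesis
      using closed_subspace[OF D] by (simp add: closed_Int_compact compact_diff)
  qed
  have "\<exists>q. 0 \<le> q \<and> q < 1 \<and> (\<forall>v\<in>?A. cmod (cf F v) \<le> q)"
  \<comment> \<open>For a trivial D the shell is empty and there is no maximum to take.\<close>
  proof (cases "?A = {}")
    case True
    then show ?thesis by (intro exI[of _ 0]) auto
  next
    case False
    obtain w where w: "w \<in> ?A" "\<And>v. v \<in> ?A \<Longrightarrow> cmod (cf F v) \<le> cmod (cf F w)"
      using continuous_attains_sup[OF \<open>compact ?A\<close> False, of "\<lambda>v. cmod (cf F v)"]
        continuous_on_norm[OF continuous_on_cf[OF F]] by blast
    have "w \<noteq> 0" using w(1) by auto
    then show ?thesis using w less by (intro exI[of _ "cmod (cf F w)"]) auto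
  qed
  then obtain q where q: "0 \<le> q" "q < 1" "\<And>v. v \<in> ?A \<Longrightarrow> cmod (cf F v) \<le> q" by blast
  note iter = self_similar_cf_power[OF sim]
  obtain C where C: "\<And>j. q ^ (2 ^ j) * (b ^ (2 * k)) ^ j \<le> C"
    using double_exponential_bounded[OF q(1,2), of "b ^ (2 * k)"] b by auto
  have "C \<ge> 0" using C[of 0] q(1) by simp
  have main: "cmod (cf F v) * (1 + (norm v)\<^sup>2) ^ k \<le> 2 ^ k + C * (2 * b\<^sup>2) ^ k" if v: "v \<in> D" for v
  proof (cases "norm v < 1")
    case True
    have "(1 + (norm v)\<^sup>2) ^ k \<le> 2 ^ k"
      using True by (intro power_mono) (auto simp: abs_square_le_1)
    then have "cmod (cf F v) * (1 + (norm v)\<^sup>2) ^ k \<le> 1 * 2 ^ k"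
      using cf_norm_le_1[OF F] by (intro mult_mono) auto
    moreover have "0 \<le> C * (2 * b\<^sup>2) ^ k" using \<open>C \<ge> 0\<close> by simp
    ultimately show ?thesis by simp
  next
    case False
    then obtain j where j: "b ^ j \<le> norm v" "norm v < b ^ Suc j"
      using power_interval[OF b, of "norm v"] by auto
    define w where "w = (1 / b ^ j) *\<^sub>R v"
    have v_eq: "v = b ^ j *\<^sub>R w" using b by (simp add: w_def)
    have "w \<in> ?A"
      using j b v D by (auto simp: w_def field_simps subspace_scale)
    then have "cmod (cf F v) \<le> q ^ (2 ^ j)"
      unfolding v_eq iter by (intro power_mono q(3)) auto
    moreover have "(1 + (norm v)\<^sup>2) ^ k \<le> (b ^ (2 * k)) ^ j * (2 * b\<^sup>2) ^ k"
    proof -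
      have "1 \<le> (norm v)\<^sup>2" using False by simp
      moreover have "(norm v)\<^sup>2 \<le> (b ^ Suc j)\<^sup>2" using j by (intro power_mono) auto
      ultimately have "1 + (norm v)\<^sup>2 \<le> 2 * (b ^ Suc j)\<^sup>2" by linarith
      then have "(1 + (norm v)\<^sup>2) ^ k \<le> (2 * (b ^ Suc j)\<^sup>2) ^ k" by (intro power_mono) auto
      also have "\<dots> = (b ^ (2 * k)) ^ j * (2 * b\<^sup>2) ^ k"
        by (simp add: power_mult_distrib flip: power_mult) (simp add: mult_ac)
      finally show ?thesis .
    qed
    ultimately have "cmod (cf F v) * (1 + (norm v)\<^sup>2) ^ k \<le> q ^ (2 ^ j) * ((b ^ (2 * k)) ^ j * (2 * b\<^sup>2) ^ k)"
      using q(1) by (intro mult_mono) auto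
    also have "\<dots> = (q ^ (2 ^ j) * (b ^ (2 * k)) ^ j) * (2 * b\<^sup>2) ^ k" by simp
    also have "\<dots> \<le> C * (2 * b\<^sup>2) ^ k" using C by (intro mult_right_mono) auto
    finally show ?thesis by (simp add: add_increasing)
  qed
  then show ?thesis by blast
qed

subsection \<open>Unitarily invariant subspaces of Hermitian matrices\<close>

lemma conj_transpose_nth: "conj_transpose U $ a $ b = cnj (U $ b $ a)"
  by (simp add: conj_transpose_def transpose_def)

lemma herm_iff: "A \<in> herm \<longleftrightarrow> (\<forall>a b. cnj (A $ b $ a) = A $ a $ b)"
  by (simp add: herm_def vec_eq_iff conj_transpose_nth)

lemma herm_diag_real:
  assumes "A \<in> herm"
  shows "complex_of_real (Re (A $ a $ a)) = A $ a $ a"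
proof -
  have "cnj (A $ a $ a) = A $ a $ a" using assms by (simp add: herm_iff)
  then show ?thesis by (simp add: complex_eq_iff)
qed

lemma conjugate_nth:
  "(U ** A ** conj_transpose U) $ a $ b = (\<Sum>d\<in>UNIV. (\<Sum>c\<in>UNIV. U $ a $ c * A $ c $ d) * cnj (U $ b $ d))"
  by (simp add: matrix_matrix_mult_def conj_transpose_nth)

lemma unitaryI: 
  fixes U :: "complex^'n^'n"
  shows "U ** conj_transpose U = mat 1 \<Longrightarrow> unitary U"
  unfolding unitary_def using matrix_left_right_inverse by blast

definition diag_matrix :: "('n \<Rightarrow> complex) \<Rightarrow> complex^'n^'n" where
  "diag_matrix d = (\<chi> a b. if a = b then d a else 0)"

definition perm_matrix :: "('n \<Rightarrow> 'n) \<Rightarrow> complex^'n^'n" where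
  "perm_matrix p = (\<chi> a b. if b = p a then 1 else 0)"

text \<open>The angle comes from the right triangle with sides 3, 4, 5, which keeps the entries rational.\<close>

definition plane_rotation :: "'n \<Rightarrow> 'n \<Rightarrow> complex^'n^'n" where
  "plane_rotation i j = (\<chi> a b.
     if a = i then (if b = i then 3/5 else if b = j then 4/5 else 0)
     else if a = j then (if b = i then - 4/5 else if b = j then 3/5 else 0)
     else if b = a then 1 else 0)"

text \<open>The complex parameter covers real symmetric and imaginary antisymmetric directions
  together. For i = j the first branch wins and the matrix need not be Hermitian.\<close>

definition offdiag :: "'n \<Rightarrow> 'n \<Rightarrow> complex \<Rightarrow> complex^'n^'n" where
  "offdiag i j z = (\<chi> a b. if a = i \<and> b = j then z else if a = j \<and> b = i then cnj z else 0)"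

definition diag_diff :: "'n \<Rightarrow> 'n \<Rightarrow> complex^'n^'n" where
  "diag_diff i j = diag_matrix (\<lambda>a. (if a = i then 1 else 0) - (if a = j then 1 else 0))"

lemma diag_matrix_mult_nth: "(diag_matrix d ** A) $ a $ b = d a * A $ a $ b"
proof -
  have "(diag_matrix d ** A) $ a $ b = (\<Sum>c\<in>UNIV. if c = a then d a * A $ c $ b else 0)"
    unfolding matrix_matrix_mult_def diag_matrix_def vec_lambda_beta by (rule sum.cong) auto
  then show ?thesis by simp
qed

lemma diag_conjugate_nth:
  "(diag_matrix d ** A ** conj_transpose (diag_matrix d)) $ a $ b = d a * A $ a $ b * cnj (d b)"
proof -
  have "(diag_matrix d ** A ** conj_transpose (diag_matrix d)) $ a $ b
    = (\<Sum>c\<in>UNIV. if c = b then (diag_matrix d ** A) $ a $ c * cnj (d b) else 0)"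
    unfolding matrix_matrix_mult_def[of "diag_matrix d ** A"] 
    unfolding vec_lambda_beta by (rule sum.cong) (auto simp: conj_transpose_nth diag_matrix_def)
  then show ?thesis by (simp add: diag_matrix_mult_nth)
qed

lemma unitary_diag_matrix:
  assumes "\<And>a. cmod (d a) = 1"
  shows "unitary (diag_matrix d)"
proof (rule unitaryI)
  have "d a * cnj (d a) = 1" for a
    using assms[of a] by (simp add: complex_norm_square[symmetric])
  then show "diag_matrix d ** conj_transpose (diag_matrix d) = mat 1"
    by (simp add: vec_eq_iff diag_matrix_mult_nth conj_transpose_nth mat_def) (simp add: diag_matrix_def)
qed

lemma perm_matrix_mult_nth: "(perm_matrix p ** A) $ a $ b = A $ p a $ b"
proof -
  have "(perm_matrix p ** A) $ a $ b = (\<Sum>c\<in>UNIV. if c = p a then A $ c $ b else 0)"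
    unfolding matrix_matrix_mult_def perm_matrix_def vec_lambda_beta by (rule sum.cong) auto
  then show ?thesis by simp
qed

lemma perm_conjugate_nth:
  "(perm_matrix p ** A ** conj_transpose (perm_matrix p)) $ a $ b = A $ p a $ p b"
proof -
  have "(perm_matrix p ** A ** conj_transpose (perm_matrix p)) $ a $ b
    = (\<Sum>c\<in>UNIV. if c = p b then (perm_matrix p ** A) $ a $ c else 0)"
    unfolding matrix_matrix_mult_def[of "perm_matrix p ** A"] 
    unfolding vec_lambda_beta by (rule sum.cong) (auto simp: conj_transpose_nth perm_matrix_def)
  then show ?thesis by (simp add: perm_matrix_mult_nth)
qed

lemma unitary_perm_matrix:
  assumes "inj p"
  shows "unitary (perm_matrix p)"
proof (rule unitaryI)
  show "perm_matrix p ** conj_transpose (perm_matrix p) = mat 1"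
    using assms
    by (auto simp: vec_eq_iff perm_matrix_mult_nth conj_transpose_nth mat_def)
       (auto simp: perm_matrix_def inj_def)
qed

lemma sum_two:
  fixes f :: "'n::finite \<Rightarrow> complex"
  assumes "i \<noteq> j"
  shows "(\<Sum>c\<in>UNIV. (if c = i then x else if c = j then y else 0) * f c) = x * f i + y * f j"
proof -
  have "(\<Sum>c\<in>UNIV. (if c = i then x else if c = j then y else 0) * f c)
     = (\<Sum>c\<in>UNIV. (if c = i then x * f c else 0) + (if c = j then y * f c else 0))"
    using assms by (intro sum.cong) auto
  then show ?thesis by (simp add: sum.distrib)
qed

lemma plane_rotation_mult_nth:
  assumes "i \<noteq> j"
  shows "(plane_rotation i j ** A) $ a $ b =
     (if a = i then 3/5 * A $ i $ b + 4/5 * A $ j $ b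
      else if a = j then - 4/5 * A $ i $ b + 3/5 * A $ j $ b else A $ a $ b)"
proof -
  have "(plane_rotation i j ** A) $ a $ b = (\<Sum>c\<in>UNIV. plane_rotation i j $ a $ c * A $ c $ b)"
    by (simp add: matrix_matrix_mult_def)
  also have "\<dots> = (if a = i then (\<Sum>c\<in>UNIV. (if c = i then 3/5 else if c = j then 4/5 else 0) * A $ c $ b)
      else if a = j then (\<Sum>c\<in>UNIV. (if c = i then - 4/5 else if c = j then 3/5 else 0) * A $ c $ b)
      else (\<Sum>c\<in>UNIV. if c = a then A $ c $ b else 0))"
    unfolding plane_rotation_def vec_lambda_beta if_distrib[of sum]
    by (simp only: if_distrib[of sum] split: if_split) (intro conjI impI sum.cong refl; simp)
  finally show ?thesis by (simp only: sum_two[OF assms]) simp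
qed

lemma unitary_plane_rotation:
  assumes "i \<noteq> j"
  shows "unitary (plane_rotation i j)"
proof (rule unitaryI)
  show "plane_rotation i j ** conj_transpose (plane_rotation i j) = mat 1"
    using assms
    by (auto simp: vec_eq_iff plane_rotation_mult_nth conj_transpose_nth mat_def)
       (auto simp: plane_rotation_def)
qed

text \<open>The difference of the two diagonal entries enters this off-diagonal entry with the
  factor 12/25, so a rotation trades unequal diagonal entries for a nonzero off-diagonal
  one.\<close>

lemma plane_rotation_conjugate_nth:
  assumes "i \<noteq> j"
  shows "(plane_rotation i j ** A ** conj_transpose (plane_rotation i j)) $ i $ j =
     - 4/5 * (3/5 * A $ i $ i + 4/5 * A $ j $ i) + 3/5 * (3/5 * A $ i $ j + 4/5 * A $ j $ j)"
proof -
  let ?R = "plane_rotation i j ** A"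
  have "(?R ** conj_transpose (plane_rotation i j)) $ i $ j
    = (\<Sum>c\<in>UNIV. (if c = i then - 4/5 else if c = j then 3/5 else 0) * ?R $ i $ c)"
    unfolding matrix_matrix_mult_def[of ?R] vec_lambda_beta using assms
    by (intro sum.cong refl) (auto simp: conj_transpose_nth plane_rotation_def)
  then show ?thesis by (simp only: sum_two[OF assms] plane_rotation_mult_nth[OF assms]) simp
qed

lemma conjugate_offdiag_nth:
  assumes "i \<noteq> j"
  shows "(U ** offdiag i j z ** conj_transpose U) $ a $ b = 
    z * U $ a $ i * cnj (U $ b $ j) + cnj z * U $ a $ j * cnj (U $ b $ i)"
proof -
  have "(\<Sum>c\<in>UNIV. U $ a $ c * offdiag i j z $ c $ d) = 
      (if d = i then cnj z * U $ a $ j else if d = j then z * U $ a $ i else 0)" for d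
  proof -
    have "(\<Sum>c\<in>UNIV. U $ a $ c * offdiag i j z $ c $ d) =
      (\<Sum>c\<in>UNIV. (if c = i then (if d = j then z else 0) else if c = j then (if d = i then cnj z else 0) else 0) * U $ a $ c)"
      using assms by (intro sum.cong refl) (auto simp: offdiag_def)
    then show ?thesis using assms by (simp only: sum_two[OF assms]) auto
  qed
  then show ?thesis
    unfolding conjugate_nth by (simp only: sum_two[OF assms]) (simp add: mult_ac)
qed

lemma offdiag_herm: "i \<noteq> j \<Longrightarrow> offdiag i j z \<in> herm"
  by (auto simp: herm_iff offdiag_def)

lemma offdiag_0: "offdiag i j 0 = 0"
  by (simp add: offdiag_def vec_eq_iff)

lemma scaleR_offdiag: "r *\<^sub>R offdiag i j z = offdiag i j (r *\<^sub>R z)"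
  by (auto simp: offdiag_def vec_eq_iff)

lemma trace_offdiag: "i \<noteq> j \<Longrightarrow> trace (offdiag i j z) = 0"
  by (auto simp: trace_def offdiag_def intro!: sum.neutral)

text \<open>A product of two transpositions: the first sends k to i, the second sends the image of l
  to j and fixes i.\<close>

lemma two_point_bijection:
  fixes i j k l :: 'a
  assumes "i \<noteq> j" "k \<noteq> l"
  obtains p where "inj p" "p k = i" "p l = j"
proof -
  define p1 where "p1 = id(k := i, i := k)"
  define p2 where "p2 = id(p1 l := j, j := p1 l)"
  have "inj p1" "inj p2" by (auto simp: inj_def p1_def p2_def)
  then have "inj (p2 \<circ> p1)" by (intro inj_compose)
  moreover have "p1 k = i" by (simp add: p1_def)
  moreover have "p1 l \<noteq> i" using \<open>inj p1\<close> \<open>p1 k = i\<close> assms by (metis injD)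
  ultimately show ?thesis using that[of "p2 \<circ> p1"] assms by (simp add: p2_def)
qed

text \<open>The ordered pairs (i, j) and (j, i) contribute the same matrix, hence the factor 1/2. On
  the diagonal the reference index k collects minus the trace, which is 0.\<close>

lemma traceless_expansion:
  fixes A :: "complex^'n^'n"
  assumes A: "A \<in> herm" "trace A = 0"
  shows "A = (\<Sum>i\<in>UNIV. \<Sum>j\<in>UNIV. if i = j then 0 else (1/2) *\<^sub>R offdiag i j (A $ i $ j))
     + (\<Sum>i\<in>UNIV. Re (A $ i $ i) *\<^sub>R diag_diff i k)"
proof -
  have re: "complex_of_real (Re (A $ a $ a)) = A $ a $ a" for a
    using A(1) by (rule herm_diag_real)
  have off: "(\<Sum>i\<in>UNIV. \<Sum>j\<in>UNIV. (if i = j then 0 else (1/2) *\<^sub>R offdiag i j (A $ i $ j)) $ a $ b)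
     = (if a = b then 0 else A $ a $ b)" for a b
  proof (cases "a = b")
    case True
    then show ?thesis by (auto simp: offdiag_def intro!: sum.neutral)
  next
    case False
    have "(\<Sum>i\<in>UNIV. \<Sum>j\<in>UNIV. (if i = j then 0 else (1/2) *\<^sub>R offdiag i j (A $ i $ j)) $ a $ b) =
      (\<Sum>i\<in>UNIV. \<Sum>j\<in>UNIV. (if j = b then (if i = a then (1/2) *\<^sub>R A $ i $ b else 0) else 0) +
         (if j = a then (if i = b then (1/2) *\<^sub>R cnj (A $ i $ a) else 0) else 0))"
      using False by (intro sum.cong refl) (auto simp: offdiag_def)
    also have "\<dots> = (1/2) *\<^sub>R A $ a $ b + (1/2) *\<^sub>R cnj (A $ b $ a)"
      by (simp add: sum.distrib)
    also have "\<dots> = A $ a $ b"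
      using A(1) by (simp add: herm_iff flip: scaleR_add_left)
    finally show ?thesis using False by simp
  qed
  have diag: "(\<Sum>i\<in>UNIV. (Re (A $ i $ i) *\<^sub>R diag_diff i k) $ a $ b) = (if a = b then A $ a $ b else 0)" for a b
  proof -
    have "(\<Sum>i\<in>UNIV. (Re (A $ i $ i) *\<^sub>R diag_diff i k) $ a $ b)
      = (\<Sum>i\<in>UNIV. if a = b then (if i = a then A $ i $ i else 0) - (if a = k then 1 else 0) * A $ i $ i else 0)"
      by (intro sum.cong refl)
        (auto simp: diag_diff_def diag_matrix_def scaleR_conv_of_real[where 'a=complex] re)
    also have "\<dots> = (if a = b then A $ a $ b - (if a = k then 1 else 0) * trace A else 0)"
      by (cases "a = b") (simp_all add: sum_subtractf trace_def)
    finally show ?thesis using A(2) by simp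
  qed
  show ?thesis
    by (simp add: vec_eq_iff off[simplified] diag[simplified])
qed

locale invariant_subspace =
  fixes V :: "(complex^'n^'n) set"
  assumes subspace: "subspace V" and herm: "V \<subseteq> herm"
    and invariant: "\<And>U s. unitary U \<Longrightarrow> s \<in> V \<Longrightarrow> U ** s ** conj_transpose U \<in> V"
begin

text \<open>Conjugation by \<open>flip k\<close> negates row and column k except for their diagonal
  entry. Subtracting it from the identity doubles those entries and kills all others; doing this for
  i and then for j leaves 4 times the entries at (i, j) and (j, i).\<close>

lemma offdiag_part_mem:
  assumes s: "s \<in> V" and ij: "i \<noteq> j"
  shows "offdiag i j (s $ i $ j) \<in> V"
proof -
  define flip where "flip k = diag_matrix (\<lambda>a. if a = k then - 1 else 1 :: complex)" for k :: 'n
  have u: "unitary (flip k)" for k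
    unfolding flip_def by (rule unitary_diag_matrix) auto
  define s1 where "s1 = s - flip i ** s ** conj_transpose (flip i)"
  define s2 where "s2 = s1 - flip j ** s1 ** conj_transpose (flip j)"
  have "s1 \<in> V" unfolding s1_def by (intro subspace_diff subspace invariant u s)
  then have "s2 \<in> V" unfolding s2_def by (intro subspace_diff subspace invariant u)
  then have "(1/4) *\<^sub>R s2 \<in> V" by (intro subspace_scale subspace)
  moreover have "cnj (s $ i $ j) = s $ j $ i" using s herm by (auto simp: herm_iff)
  then have "s2 = offdiag i j (4 * s $ i $ j)"
    using ij by (auto simp: vec_eq_iff s2_def s1_def flip_def diag_conjugate_nth offdiag_def)
  then have "(1/4) *\<^sub>R s2 = offdiag i j (s $ i $ j)"
    by (simp add: scaleR_offdiag scaleR_conv_of_real[where 'a=complex])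
  ultimately show ?thesis by simp
qed

text \<open>A diagonal unitary turns the phase of z into that of w, a real factor adjusts the
  modulus, and a permutation matrix moves the position (i, j) to (k, l).\<close>

lemma offdiag_all_mem:
  assumes z: "offdiag i j z \<in> V" "z \<noteq> 0" and ij: "i \<noteq> j" and kl: "k \<noteq> l"
  shows "offdiag k l w \<in> V"
proof -
  have "offdiag i j w \<in> V"
  proof (cases "w = 0")
    case True
    then show ?thesis using subspace_0[OF subspace] by (simp add: offdiag_0)
  next
    case False
    define u where "u = sgn w / sgn z"
    have u: "cmod u = 1" using False z by (simp add: u_def norm_divide norm_sgn)
    define D where "D = diag_matrix (\<lambda>a. if a = i then u else 1)"
    have "unitary D" unfolding D_def using u by (intro unitary_diag_matrix) auto
    then have "(cmod w / cmod z) *\<^sub>R (D ** offdiag i j z ** conj_transpose D) \<in> V"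
      by (intro subspace_scale subspace invariant z)
    moreover have "(cmod w / cmod z) *\<^sub>R (u * z) = w"
      using False z(2) by (simp add: u_def sgn_div_norm scaleR_conv_of_real field_simps)
    then have "(cmod w / cmod z) *\<^sub>R (D ** offdiag i j z ** conj_transpose D) = offdiag i j w"
      using ij by (auto simp: vec_eq_iff D_def diag_conjugate_nth offdiag_def mult.commute
          simp flip: complex_cnj_mult complex_cnj_scaleR)
    ultimately show ?thesis by simp
  qed
  moreover obtain p where p: "inj p" "p k = i" "p l = j"
    using two_point_bijection[OF ij kl] .
  have "perm_matrix p ** offdiag i j w ** conj_transpose (perm_matrix p) = offdiag k l w"
    using p by (auto simp: vec_eq_iff perm_conjugate_nth offdiag_def inj_eq simp flip: p(2,3))
  ultimately show ?thesis using invariant[OF unitary_perm_matrix[OF p(1)]] by metis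
qed

lemma exists_offdiag_mem:
  assumes s: "s \<in> V" and nonscalar: "\<And>x::real. s \<noteq> mat (complex_of_real x)"
  obtains i j z where "i \<noteq> j" "z \<noteq> 0" "offdiag i j z \<in> V"
proof (cases "\<exists>i j. i \<noteq> j \<and> s $ i $ j \<noteq> 0")
  case True
  then show ?thesis using offdiag_part_mem[OF s] that by blast
next
  case False
  have real: "complex_of_real (Re (s $ a $ a)) = s $ a $ a" for a
    using s herm by (intro herm_diag_real) blast
  have "\<exists>i j. s $ i $ i \<noteq> s $ j $ j"
  proof (rule ccontr)
    assume eq: "\<not> ?thesis"
    obtain k :: 'n where True by simp
    have "s = mat (complex_of_real (Re (s $ k $ k)))"
      unfolding real using False eq by (auto simp: vec_eq_iff mat_def)
    then show False using nonscalar by blast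
  qed
  then obtain i j where ij: "s $ i $ i \<noteq> s $ j $ j" by blast
  then have "i \<noteq> j" by auto
  then have off: "s $ i $ j = 0" "s $ j $ i = 0" using False by metis+
  define s' where "s' = plane_rotation i j ** s ** conj_transpose (plane_rotation i j)"
  have "s' \<in> V" unfolding s'_def by (intro invariant s unitary_plane_rotation \<open>i \<noteq> j\<close>)
  moreover have "s' $ i $ j = 12/25 * (s $ j $ j - s $ i $ i)"
    unfolding s'_def plane_rotation_conjugate_nth[OF \<open>i \<noteq> j\<close>]
    using off by (simp add: algebra_simps)
  then have "s' $ i $ j \<noteq> 0" using ij by (simp only: mult_eq_0_iff right_minus_eq) simp
  ultimately show ?thesis using offdiag_part_mem \<open>i \<noteq> j\<close> that by blast
qed

lemma traceless_subset:
  assumes s: "s \<in> V" and nonscalar: "\<And>x::real. s \<noteq> mat (complex_of_real x)"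
    and A: "A \<in> herm" "trace A = 0"
  shows "A \<in> V"
proof -
  have off: "offdiag k l w \<in> V" if "k \<noteq> l" for k l w
    using exists_offdiag_mem[OF s nonscalar] offdiag_all_mem that by metis
  have dd: "diag_diff k l \<in> V" for k l
  proof (cases "k = l")
    case True
    then have "diag_diff k l = 0" by (simp add: diag_diff_def diag_matrix_def vec_eq_iff)
    then show ?thesis using subspace_0[OF subspace] by simp
  next
    case False
    \<comment> \<open>With cos = 3/5 and sin = 4/5, the double angle has sine 24/25 and cosine -
      7/25. The rotated matrix has 24/25 and - 24/25 on the diagonal and - 7/25 off it, which
      explains both corrections below.\<close>
    let ?W = "plane_rotation k l ** offdiag k l 1 ** conj_transpose (plane_rotation k l)"
    have "?W \<in> V" by (intro invariant unitary_plane_rotation off False)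
    then have "(25/24) *\<^sub>R (?W + (7/25) *\<^sub>R offdiag k l 1) \<in> V"
      by (intro subspace_scale subspace_add subspace off False)
    moreover have "(25/24) *\<^sub>R (?W + (7/25) *\<^sub>R offdiag k l 1) = diag_diff k l"
      unfolding vec_eq_iff using False
      by (auto simp: conjugate_offdiag_nth[OF False] diag_diff_def diag_matrix_def)
         (auto simp: plane_rotation_def offdiag_def scaleR_conv_of_real)
    ultimately show ?thesis by simp
  qed
  obtain k :: 'n where True by simp
  have "(\<Sum>i\<in>UNIV. \<Sum>j\<in>UNIV. if i = j then 0 else (1/2) *\<^sub>R offdiag i j (A $ i $ j))
     + (\<Sum>i\<in>UNIV. Re (A $ i $ i) *\<^sub>R diag_diff i k) \<in> V"
    by (intro subspace_add subspace subspace_sum) (auto intro!: subspace_scale subspace_0 subspace off dd)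
  then show ?thesis using traceless_expansion[OF A] by metis
qed

end

subsection \<open>Supports\<close>

text \<open>The complement of the support is covered by the null sets of a countable basis.\<close>

lemma AE_msupport:
  fixes F :: "'a::second_countable_topology measure"
  assumes sets_F: "sets F = sets borel"
  shows "AE x in F. x \<in> msupport F"
proof -
  obtain \<B> :: "'a set set" where \<B>: "countable \<B>" "topological_basis \<B>"
    using ex_countable_basis by blast
  let ?N = "\<Union>b\<in>{b \<in> \<B>. emeasure F b = 0}. b"
  have "?N \<in> null_sets F"
    using \<B> sets_F
    by (intro null_sets_UN') (auto simp: null_sets_def topological_basis_open)
  moreover have "{x \<in> space F. x \<notin> msupport F} \<subseteq> ?N"
  proof
    fix x assume "x \<in> {x \<in> space F. x \<notin> msupport F}"
    then obtain U where U: "open U" "x \<in> U" "emeasure F U = 0"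
      by (auto simp: msupport_def zero_less_iff_neq_zero)
    then obtain b where b: "b \<in> \<B>" "x \<in> b" "b \<subseteq> U"
      using \<B>(2) topological_basisE by blast
    have "emeasure F b \<le> emeasure F U"
      using b U sets_F by (intro emeasure_mono) auto
    then show "x \<in> ?N" using b U by auto
  qed
  ultimately show ?thesis by (rule AE_I')
qed

lemma msupport_subset:
  assumes sets_F: "sets F = sets borel" and C: "closed C" "AE x in F. x \<in> C"
  shows "msupport F \<subseteq> C"
proof
  fix x assume x: "x \<in> msupport F"
  show "x \<in> C"
  proof (rule ccontr)
    assume "x \<notin> C"
    then have "emeasure F (- C) > 0"
      using x C(1) by (auto simp: msupport_def open_Compl)
    moreover have "AE x in F. x \<notin> - C" using C(2) by simp
    then have "emeasure F (- C) = 0"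
      using sets_F C(1) by (subst (asm) AE_iff_measurable[where N="- C"])
        (auto dest: sets_eq_imp_space_eq)
    ultimately show False by simp
  qed
qed

subsection \<open>Constant directions\<close>

text \<open>The equality case of the triangle inequality: after division by the phase of the mean, 1
  minus the real part of the integrand is nonnegative with integral 0.\<close>

lemma cf_norm_1_imp_AE_const:
  fixes F :: "'a::euclidean_space measure"
  assumes F: "prob_space F" "sets F = sets borel" and one: "cmod (cf F v) = 1"
  shows "AE x in F. iexp (v \<bullet> x) = cf F v"
proof -
  interpret prob_space F by fact
  define u where "u = cf F v"
  have u: "cnj u * u = 1" using one by (simp add: u_def complex_norm_square[symmetric] mult.commute)
  have int: "integrable F (\<lambda>x. cnj u * iexp (v \<bullet> x))"
    by (intro integrable_mult_right integrable_iexp_inner F)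
  have le: "Re (cnj u * iexp (v \<bullet> x)) \<le> 1" for x
    using complex_Re_le_cmod[of "cnj u * iexp (v \<bullet> x)"] one by (simp add: norm_mult u_def)
  have int1: "integrable F (\<lambda>x. 1 - Re (cnj u * iexp (v \<bullet> x)))"
    using int by (intro Bochner_Integration.integrable_diff integrable_Re) auto
  have "(\<integral>x. 1 - Re (cnj u * iexp (v \<bullet> x)) \<partial>F) = 1 - Re (CLINT x|F. cnj u * iexp (v \<bullet> x))"
    using int by (subst Bochner_Integration.integral_diff) (auto simp: prob_space simp del: times_complex.sel)
  also have "(CLINT x|F. cnj u * iexp (v \<bullet> x)) = cnj u * cf F v"
    by (simp add: cf_def)
  also have "1 - Re (cnj u * cf F v) = 0" using u by (simp add: u_def[symmetric] del: times_complex.sel)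
  finally have "AE x in F. 1 - Re (cnj u * iexp (v \<bullet> x)) = 0"
    using int1 le by (subst integral_nonneg_eq_0_iff_AE[symmetric]) (auto simp del: times_complex.sel)
  then show ?thesis
  proof eventually_elim
    fix x assume "1 - Re (cnj u * iexp (v \<bullet> x)) = 0"
    then have re: "Re (cnj u * iexp (v \<bullet> x)) = 1" by simp
    have "cmod (cnj u * iexp (v \<bullet> x)) = 1" using one by (simp add: norm_mult u_def)
    with re have "cnj u * iexp (v \<bullet> x) = 1"
      by (metis complex_eq_iff cmod_eq_Re one_complex.sel norm_one abs_one complex_neq_0 cmod_power2
          add_cancel_left_right power_one power2_eq_square power_eq_0_iff one_complex.simps)
    then have "u * (cnj u * iexp (v \<bullet> x)) = u" by simp
    then have "(cnj u * u) * iexp (v \<bullet> x) = u" by (simp only: mult_ac)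
    then have "iexp (v \<bullet> x) = u" by (simp only: u mult_1_left)
    then show "iexp (v \<bullet> x) = cf F v" by (simp only: u_def)
  qed
qed

text \<open>All t / r^k are multiples of 2 pi, yet they tend to 0, so some of them is 0.\<close>

lemma iexp_scaled_eq_1:
  assumes r: "r > 1" and one: "\<And>k::nat. iexp (t / r ^ k) = 1"
  shows "t = 0"
proof (rule ccontr)
  assume t: "t \<noteq> 0"
  obtain k where k: "\<bar>t\<bar> < r ^ k" using real_arch_pow[OF r] by blast
  then have "\<bar>t / r ^ k\<bar> < 1" using r by (simp add: abs_divide)
  moreover obtain n :: int where n: "t / r ^ k = of_int (2 * n) * pi"
    using one[of k] unfolding exp_eq_1 by auto
  have "n \<noteq> 0" using n t r by auto
  then have "1 \<le> \<bar>real_of_int n\<bar>" by linarith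
  then have "2 * pi \<le> \<bar>t / r ^ k\<bar>" unfolding n by (simp add: abs_mult)
  ultimately show False using pi_gt3 by linarith
qed

lemma cf_scaled_norm_1_imp_const:
  fixes F :: "'a::euclidean_space measure"
  assumes F: "prob_space F" "sets F = sets borel" and r: "r > 1"
    and one: "\<And>k::nat. cmod (cf F ((1 / r ^ k) *\<^sub>R s)) = 1"
  shows "\<exists>c. AE x in F. s \<bullet> x = c"
proof -
  interpret prob_space F by fact
  have all: "AE x in F. \<forall>k. iexp (((1 / r ^ k) *\<^sub>R s) \<bullet> x) = cf F ((1 / r ^ k) *\<^sub>R s)"
    \<comment> \<open>One null set serves all k. Comparing x with a sample point y outside it avoids
      having to determine the phases.\<close>
    unfolding AE_all_countable using cf_norm_1_imp_AE_const[OF F one] by blast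
  then obtain y where y: "\<And>k. iexp (((1 / r ^ k) *\<^sub>R s) \<bullet> y) = cf F ((1 / r ^ k) *\<^sub>R s)"
    using eventually_happens[OF all] by (auto simp: trivial_limit_def)
  from all have "AE x in F. s \<bullet> x = s \<bullet> y"
  proof eventually_elim
    fix x assume x: "\<forall>k. iexp (((1 / r ^ k) *\<^sub>R s) \<bullet> x) = cf F ((1 / r ^ k) *\<^sub>R s)"
    have "s \<bullet> x - s \<bullet> y = 0"
    proof (rule iexp_scaled_eq_1[OF r])
      fix k
      have "iexp ((s \<bullet> x - s \<bullet> y) / r ^ k) = iexp (((1 / r ^ k) *\<^sub>R s) \<bullet> x) / iexp (((1 / r ^ k) *\<^sub>R s) \<bullet> y)"
        by (simp add: diff_divide_distrib right_diff_distrib flip: exp_diff)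
      also have "\<dots> = 1" using x y by (metis divide_self exp_not_eq_zero)
      finally show "iexp ((s \<bullet> x - s \<bullet> y) / r ^ k) = 1" .
    qed
    then show "s \<bullet> x = s \<bullet> y" by simp
  qed
  then show ?thesis by blast
qed

lemma AE_const_imp_return:
  assumes F: "prob_space F" "sets F = sets borel" and c: "AE x in F. x = c"
  shows "F = return borel c"
proof -
  interpret prob_space F by fact
  have "F = return F c" using c by (rule AE_eq_constD)
  also have "\<dots> = return borel c" using F(2) by (rule return_cong)
  finally show ?thesis .
qed

lemma all_const_imp_return:
  fixes F :: "'a::euclidean_space measure"
  assumes F: "prob_space F" "sets F = sets borel" and const: "\<And>s. \<exists>c. AE x in F. s \<bullet> x = c"
  shows "\<exists>A. (AE x in F. x = A) \<and> F = return borel A"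
proof -
  obtain c where c: "\<And>s. AE x in F. s \<bullet> x = c s" using const by metis
  have "AE x in F. \<forall>b\<in>Basis. b \<bullet> x = c b"
    using c by (intro AE_finite_allI) auto
  then have "AE x in F. x = (\<Sum>b\<in>Basis. c b *\<^sub>R b)"
  proof eventually_elim
    fix x assume "\<forall>b\<in>Basis. b \<bullet> x = c b"
    then have "(\<Sum>b\<in>Basis. c b *\<^sub>R b) = (\<Sum>b\<in>Basis. (x \<bullet> b) *\<^sub>R b)"
      by (intro sum.cong) (auto simp: inner_commute)
    then show "x = (\<Sum>b\<in>Basis. c b *\<^sub>R b)" by (simp add: euclidean_representation)
  qed
  then show ?thesis using AE_const_imp_return[OF F] by blast
qed

subsection \<open>Stable distributions\<close>

lemma cf_stable_sum:
  fixes F :: "'a::euclidean_space measure"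
  assumes F: "prob_space F" "sets F = sets borel" and b: "b > 0"
    and eq: "F = distr (F \<Otimes>\<^sub>M F) borel (\<lambda>(x, y). (1 / b) *\<^sub>R (x + y - A))"
  shows "cmod (cf F (b *\<^sub>R s)) = (cmod (cf F s))\<^sup>2"
proof -
  interpret prob_space F by fact
  interpret P: pair_prob_space F F ..
  note [measurable_cong] = F(2)
  have "cf F (b *\<^sub>R s) = (CLINT z|distr (F \<Otimes>\<^sub>M F) borel (\<lambda>(x, y). (1 / b) *\<^sub>R (x + y - A)). iexp (b *\<^sub>R s \<bullet> z))"
    unfolding cf_def by (subst eq) (rule refl)
  also have "\<dots> = (CLINT p|F \<Otimes>\<^sub>M F. iexp (b *\<^sub>R s \<bullet> (case p of (x, y) \<Rightarrow> (1 / b) *\<^sub>R (x + y - A))))"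
    by (rule integral_distr) measurable
  also have "\<dots> = (CLINT p|F \<Otimes>\<^sub>M F. (case p of (x, y) \<Rightarrow> iexp (- (s \<bullet> A)) * iexp (s \<bullet> x) * iexp (s \<bullet> y)))"
    using b by (intro Bochner_Integration.integral_cong refl)
      (auto simp: inner_diff_right inner_add_right algebra_simps simp flip: exp_add)
  also have "\<dots> = (CLINT x|F. CLINT y|F. iexp (- (s \<bullet> A)) * iexp (s \<bullet> x) * iexp (s \<bullet> y))"
  proof -
    have "integrable (F \<Otimes>\<^sub>M F) (\<lambda>(x, y). iexp (- (s \<bullet> A)) * iexp (s \<bullet> x) * iexp (s \<bullet> y))"
      by (rule P.integrable_const_bound[where B=1]) (auto simp: norm_mult)
    from P.integral_fst'[OF this] show ?thesis by simp
  qed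
  also have "\<dots> = iexp (- (s \<bullet> A)) * cf F s * cf F s"
    by (simp add: cf_def)
  finally show ?thesis by (simp add: norm_mult power2_eq_square)
qed

text \<open>A scale b <= 1 would force |phi| = 1 everywhere, hence a point mass: for b = 1 by
  connectedness, for b < 1 because b^j s tends to 0, where phi is 1, while |phi s| ^ (2 ^ j) tends
  to 0 unless |phi s| = 1.\<close>

lemma self_similar_scale_gt_1:
  fixes F :: "'a::euclidean_space measure"
  assumes F: "prob_space F" "sets F = sets borel" and b: "b > 0"
    and sim: "\<And>s. cmod (cf F (b *\<^sub>R s)) = (cmod (cf F s))\<^sup>2"
    and nd: "\<not> (\<exists>A. (AE x in F. x = A) \<and> F = return borel A)"
  shows "b > 1"
proof (rule ccontr)
  assume "\<not> b > 1"
  interpret prob_space F by fact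
  have cf0: "cf F 0 = 1" by (simp add: cf_def prob_space)
  note iter = self_similar_cf_power[OF sim]
  have one: "cmod (cf F s) = 1" for s
  proof (rule ccontr)
    assume "cmod (cf F s) \<noteq> 1"
    then have lt: "cmod (cf F s) < 1" using cf_norm_le_1[OF F, of s] by simp
    show False
    proof (cases "b = 1")
      case True
      \<comment> \<open>For b = 1 the modulus equals its own square, so it only takes the values 0
        and 1; continuity along the segment from 0 to s would also produce 1/2.\<close>
      have "cmod (cf F s) = 0" using sim[of s] lt True by (simp add: power2_eq_square)
      moreover have "continuous_on {0..1} (\<lambda>t. cmod (cf F (t *\<^sub>R s)))"
        by (intro continuous_on_norm continuous_on_compose2[OF continuous_on_cf[OF F, of UNIV]] continuous_intros) auto
      ultimately obtain t where "cmod (cf F (t *\<^sub>R s)) = 1 / 2"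
        using IVT2'[of "\<lambda>t. cmod (cf F (t *\<^sub>R s))" 1 "1/2" 0] cf0 by auto
      then show False using sim[of "t *\<^sub>R s"] True by (simp add: power2_eq_square)
    next
      case False
      then have "b < 1" using \<open>\<not> b > 1\<close> by simp
      then have "(\<lambda>j. b ^ j) \<longlonglongrightarrow> 0" using b by (intro LIMSEQ_realpow_zero less_imp_le)
      then have "(\<lambda>j. b ^ j *\<^sub>R s) \<longlonglongrightarrow> 0 *\<^sub>R s" by (intro tendsto_scaleR tendsto_const)
      then have "(\<lambda>j. cf F (b ^ j *\<^sub>R s)) \<longlonglongrightarrow> cf F 0"
        using continuous_on_tendsto_compose[OF continuous_on_cf[OF F, of UNIV]] by simp
      then have "(\<lambda>j. cmod (cf F s) ^ (2 ^ j)) \<longlonglongrightarrow> 1"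
        using tendsto_norm iter cf0 by fastforce
      moreover have "(\<lambda>j. cmod (cf F s) ^ (2 ^ j)) \<longlonglongrightarrow> 0"
        using LIMSEQ_subseq_LIMSEQ[OF LIMSEQ_realpow_zero[OF norm_ge_zero lt], of "\<lambda>j. 2 ^ j"]
        by (simp add: strict_mono_def comp_def)
      ultimately show False using LIMSEQ_unique by fastforce
    qed
  qed
  have "\<exists>c. AE x in F. s \<bullet> x = c" for s
    \<comment> \<open>The modulus is 1 at every vector, so any ratio above 1 works; 2 is an
      arbitrary choice.\<close>
    using one by (intro cf_scaled_norm_1_imp_const[OF F, of 2]) auto
  then show False using all_const_imp_return[OF F] nd by blast
qed

lemma self_similar_cf_lt_1:
  fixes F :: "'a::euclidean_space measure"
  assumes F: "prob_space F" "sets F = sets borel" and b: "b > 1"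
    and sim: "\<And>s. cmod (cf F (b *\<^sub>R s)) = (cmod (cf F s))\<^sup>2"
    and nc: "\<not> (\<exists>c. AE x in F. s \<bullet> x = c)"
  shows "cmod (cf F s) < 1"
proof (rule ccontr)
  assume "\<not> cmod (cf F s) < 1"
  then have 1: "cmod (cf F s) = 1" using cf_norm_le_1[OF F, of s] by simp
  have "cmod (cf F ((1 / b ^ k) *\<^sub>R s)) = 1" for k
  proof (induction k)
    case (Suc k)
    have "b *\<^sub>R (1 / b ^ Suc k) *\<^sub>R s = (1 / b ^ k) *\<^sub>R s" using b by simp
    then have "(cmod (cf F ((1 / b ^ Suc k) *\<^sub>R s)))\<^sup>2 = 1"
      using sim[of "(1 / b ^ Suc k) *\<^sub>R s"] Suc.IH by metis
    then show ?case by (intro power2_eq_imp_eq[of _ 1]) auto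
  qed (use 1 in simp)
  then show False using cf_scaled_norm_1_imp_const[OF F b] nc by blast
qed

subsection \<open>Hyperplanes are null sets\<close>

text \<open>With the other coordinates fixed, the equation determines coordinate i because its
  coefficient is nonzero; Tonelli then integrates a null section.\<close>

lemma hyperplane_null_PiM:
  fixes k :: "'i \<Rightarrow> real"
  assumes fin: "finite I" and i: "i \<in> I" "k i \<noteq> 0"
  shows "emeasure (PiM I (\<lambda>_. lborel)) {c \<in> space (PiM I (\<lambda>_. lborel)). (\<Sum>j\<in>I. k j * c j) = d} = 0"
proof -
  define J where "J = I - {i}"
  have J: "finite J" "i \<notin> J" "insert i J = I" using fin i by (auto simp: J_def)
  let ?L = "PiM I (\<lambda>_. lborel :: real measure)"
  let ?H = "{c \<in> space ?L. (\<Sum>j\<in>I. k j * c j) = d}"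
  let ?f = "\<lambda>c. indicator {d} (\<Sum>j\<in>I. k j * c j) :: ennreal"
  have [measurable]: "?f \<in> borel_measurable ?L" by measurable
  have "?H \<in> sets ?L" by measurable
  then have "emeasure ?L ?H = (\<integral>\<^sup>+c. indicator ?H c \<partial>?L)" by simp
  also have "\<dots> = (\<integral>\<^sup>+c. ?f c \<partial>?L)"
    by (intro nn_integral_cong) (auto split: split_indicator)
  also have "\<dots> = (\<integral>\<^sup>+c. (\<integral>\<^sup>+y. ?f (c(i := y)) \<partial>lborel) \<partial>PiM J (\<lambda>_. lborel))"
    using lborel_product.product_nn_integral_insert[of J i ?f] J by simp
  also have "\<dots> = (\<integral>\<^sup>+c. 0 \<partial>PiM J (\<lambda>_. lborel :: real measure))"
  proof (rule nn_integral_cong)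
    fix c :: "'i \<Rightarrow> real"
    have sum: "(\<Sum>j\<in>I. k j * (c(i := y)) j) = k i * y + (\<Sum>j\<in>J. k j * c j)" for y
    proof -
      have "(\<Sum>j\<in>J. k j * (c(i := y)) j) = (\<Sum>j\<in>J. k j * c j)"
        using J by (intro sum.cong) auto
      then show ?thesis using J by (simp flip: J(3))
    qed
    have "AE y in lborel. y \<noteq> (d - (\<Sum>j\<in>J. k j * c j)) / k i" by (rule AE_lborel_singleton)
    then have "AE y in lborel. ?f (c(i := y)) = 0"
    proof eventually_elim
      fix y assume "y \<noteq> (d - (\<Sum>j\<in>J. k j * c j)) / k i"
      then show "?f (c(i := y)) = 0"
        unfolding sum using i(2) by (auto simp: field_simps split: split_indicator)
    qed
    then show "(\<integral>\<^sup>+y. ?f (c(i := y)) \<partial>lborel) = 0"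
      by (simp add: nn_integral_0_iff_AE cong: nn_integral_cong_AE)
  qed
  finally show ?thesis by simp
qed

text \<open>The points x and y certify that s is not orthogonal to the directions of S, so in
  coordinates the hyperplane is given by an equation with a nonzero coefficient.\<close>

lemma density_not_on_hyperplane:
  fixes S :: "'a::euclidean_space set"
  assumes F: "prob_space F" and dens: "has_bounded_continuous_density_on F S"
    and S: "affine S" and xy: "x \<in> S" "y \<in> S" "s \<bullet> x \<noteq> s \<bullet> y"
  shows "\<not> (AE z in F. s \<bullet> z = d)"
proof
  assume AE: "AE z in F. s \<bullet> z = d"
  interpret prob_space F by fact
  have "S \<noteq> {}" using xy by auto
  obtain a B where aB: "(SOME (a, B). orthonormal_frame S a B) = (a, B)" "orthonormal_frame S a B"
    using orthonormal_frame_SOME[OF S \<open>S \<noteq> {}\<close>] .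
  interpret orthonormal_system B
    using aB(2) by unfold_locales (auto simp: orthonormal_frame_def)
  have al: "affine_lebesgue S = distr L borel (\<lambda>c. a + emb c)"
    by (simp add: affine_lebesgue_def aB(1) emb_def[abs_def])
  have "\<exists>b\<in>B. s \<bullet> b \<noteq> 0"
  proof (rule ccontr)
    assume no: "\<not> ?thesis"
    have "s \<bullet> v = 0" if "v \<in> span B" for v
      using that by (induction rule: span_induct_alt) (use no in \<open>auto simp: inner_add_right\<close>)
    moreover have "\<exists>v\<in>span B. x = a + v" "\<exists>v\<in>span B. y = a + v"
      using xy aB(2) by (auto simp: orthonormal_frame_def)
    ultimately show False using xy(3) by (auto simp: inner_add_right)
  qed
  then obtain b where b: "b \<in> B" "s \<bullet> b \<noteq> 0" by blast
  let ?H = "{z. s \<bullet> z = d}"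
  have H: "?H \<in> sets borel" by (intro borel_closed closed_hyperplane)
  have "emeasure (affine_lebesgue S) ?H = emeasure L ((\<lambda>c. a + emb c) -` ?H \<inter> space L)"
    unfolding al by (rule emeasure_distr) (use H in auto)
  also have "(\<lambda>c. a + emb c) -` ?H \<inter> space L = {c \<in> space L. (\<Sum>b\<in>B. (s \<bullet> b) * c b) = d - s \<bullet> a}"
    by (auto simp: inner_add_right emb_inner_right)
  also have "emeasure L \<dots> = 0"
    using b by (intro hyperplane_null_PiM[where i=b] finite_B)
  finally have "?H \<in> null_sets (affine_lebesgue S)"
    using H by (simp add: null_sets_def al)
  then have null: "AE z in affine_lebesgue S. z \<notin> ?H" by (rule AE_not_in)
  obtain p :: "'a \<Rightarrow> real" where p: "continuous_on S p"
      "F = density (affine_lebesgue S) (\<lambda>x. ennreal (p x) * indicator S x)"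
    using dens by (auto simp: has_bounded_continuous_density_on_def)
  have "S = (+) a ` span B" using aB(2) by (auto simp: orthonormal_frame_def)
  then have "closed S" by (simp only: closed_translation closed_span)
  then have [measurable]: "S \<in> sets borel" by simp
  have m: "(\<lambda>x. ennreal (p x) * indicator S x) \<in> borel_measurable (affine_lebesgue S)"
  proof -
    \<comment> \<open>Continuity of p is known on S only, so measurability is claimed for p cut off
      outside S.\<close>
    have "(\<lambda>x. indicator S x *\<^sub>R p x) \<in> borel_measurable borel"
      using p(1) by (intro borel_measurable_continuous_on_indicator) auto
    then have "(\<lambda>x. ennreal (indicator S x *\<^sub>R p x)) \<in> borel_measurable borel" by measurable
    moreover have "ennreal (indicator S x *\<^sub>R p x) = ennreal (p x) * indicator S x" for x
      by (auto split: split_indicator)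
    ultimately show ?thesis by (simp add: al)
  qed
  have "AE z in F. z \<notin> ?H"
    unfolding p(2) AE_density[OF m] using null by eventually_elim simp
  with AE have "AE z in F. False" by eventually_elim auto
  then show False by simp
qed

subsection \<open>Invariance of the constant directions\<close>

lemma conj_transpose_mult: "conj_transpose (A ** B) = conj_transpose B ** conj_transpose A"
  by (simp add: vec_eq_iff conj_transpose_nth matrix_matrix_mult_def mult.commute)

lemma conj_transpose_conj_transpose: "conj_transpose (conj_transpose A) = A"
  by (simp add: vec_eq_iff conj_transpose_nth)

lemma conjugate_herm: "s \<in> herm \<Longrightarrow> U ** s ** conj_transpose U \<in> herm"
  by (simp add: herm_def conj_transpose_mult conj_transpose_conj_transpose matrix_mul_assoc)

text \<open>Cyclicity of the trace, after \<open>inner_herm\<close> turns both inner products into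
  traces.\<close>

lemma inner_conjugate:
  fixes s :: "complex^'n^'n"
  assumes "s \<in> herm"
  shows "(U ** s ** conj_transpose U) \<bullet> x = s \<bullet> (conj_transpose U ** x ** U)"
proof -
  have "trace (U ** s ** conj_transpose U ** x) = trace (U ** (s ** conj_transpose U ** x))"
    by (simp add: matrix_mul_assoc)
  also have "\<dots> = trace (s ** conj_transpose U ** x ** U)" by (rule trace_mul_sym)
  also have "\<dots> = trace (s ** (conj_transpose U ** x ** U))"
    by (simp add: matrix_mul_assoc)
  finally show ?thesis
    using assms by (simp add: inner_herm conjugate_herm)
qed

lemma inner_mat_real:
  fixes x :: "complex^'n^'n"
  shows "mat (complex_of_real r) \<bullet> x = r * Re (trace x)"
proof -
  have "mat (complex_of_real r) \<bullet> x = (\<Sum>i\<in>UNIV. \<Sum>j\<in>UNIV. if j = i then r * Re (x $ i $ i) else 0)"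
    unfolding inner_vec_def by (intro sum.cong refl) (auto simp: mat_def inner_complex_def)
  then show ?thesis by (simp add: trace_def sum_distrib_left)
qed

lemma mat_real_herm: "mat (complex_of_real r) \<in> herm"
  by (auto simp: herm_iff mat_def)

lemma trace_mat_real: "trace (mat (complex_of_real r) :: complex^'n^'n) = of_real (r * CARD('n))"
  by (simp add: trace_def mat_def)

lemma trace_herm_real:
  fixes x :: "complex^'n^'n"
  assumes "x \<in> herm"
  shows "trace x = complex_of_real (Re (trace x))"
  unfolding trace_def using herm_diag_real[OF assms] by (simp add: Re_sum)

text \<open>The conjugation is moved from s to x and absorbed by the invariance under the adjoint of
  U. The constant c stays the same, on which the sign argument in
  \<open>invariant_stable_cases\<close> rests.\<close>

lemma AE_conjugate:
  fixes F :: "(complex^'n^'n) measure"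
  assumes inv: "unitarily_invariant F" and sets_F: "sets F = sets borel" and U: "unitary U"
    and s: "s \<in> herm" and AE: "AE x in F. s \<bullet> x = c"
  shows "AE x in F. (U ** s ** conj_transpose U) \<bullet> x = c"
proof -
  note [measurable_cong] = sets_F
  have U': "unitary (conj_transpose U)"
    using U by (simp add: unitary_def conj_transpose_conj_transpose)
  let ?g = "\<lambda>x. conj_transpose U ** x ** U"
  have "continuous_on UNIV ?g"
    unfolding matrix_matrix_mult_def by (intro continuous_intros)
  then have [measurable]: "?g \<in> borel_measurable borel" by (rule borel_measurable_continuous_onI)
  have distr: "distr F borel ?g = F"
    using inv U' by (auto simp: unitarily_invariant_def conj_transpose_conj_transpose)
  have "AE x in distr F borel ?g. s \<bullet> x = c" unfolding distr by (rule AE)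
  then have "AE x in F. s \<bullet> ?g x = c"
    by (subst (asm) AE_distr_iff) auto
  then show ?thesis by (simp add: inner_conjugate[OF s])
qed

lemma invariant_const_directions:
  fixes F :: "(complex^'n^'n) measure"
  assumes "unitarily_invariant F" "sets F = sets borel"
  shows "invariant_subspace {s \<in> herm. \<exists>c. AE x in F. s \<bullet> x = c}"
proof
  show "subspace {s \<in> herm. \<exists>c. AE x in F. s \<bullet> x = c}"
    unfolding subspace_def
  proof (intro conjI ballI allI)
    show "0 \<in> {s \<in> herm. \<exists>c. AE x in F. s \<bullet> x = c}"
      using subspace_0[OF subspace_herm] by auto
  next
    fix s t assume st: "s \<in> {s \<in> herm. \<exists>c. AE x in F. s \<bullet> x = c}" "t \<in> {s \<in> herm. \<exists>c. AE x in F. s \<bullet> x = c}"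
    then obtain c d where "AE x in F. s \<bullet> x = c" "AE x in F. t \<bullet> x = d" by auto
    then have "AE x in F. (s + t) \<bullet> x = c + d"
      by eventually_elim (simp add: inner_add_left)
    then show "s + t \<in> {s \<in> herm. \<exists>c. AE x in F. s \<bullet> x = c}"
      using st subspace_add[OF subspace_herm] by auto
  next
    fix r s assume s: "s \<in> {s \<in> herm. \<exists>c. AE x in F. s \<bullet> x = c}"
    then obtain c where "AE x in F. s \<bullet> x = c" by auto
    then have "AE x in F. (r *\<^sub>R s) \<bullet> x = r * c" by eventually_elim simp
    then show "r *\<^sub>R s \<in> {s \<in> herm. \<exists>c. AE x in F. s \<bullet> x = c}"
      using s subspace_scale[OF subspace_herm] by auto
  qed
qed (use AE_conjugate[OF assms] conjugate_herm in auto)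

text \<open>With this second subspace, \<open>traceless_subset\<close> spreads the value 0 from one
  off-diagonal matrix to all traceless ones; constancy alone would leave the values open.\<close>

lemma invariant_null_directions:
  fixes F :: "(complex^'n^'n) measure"
  assumes "unitarily_invariant F" "sets F = sets borel"
  shows "invariant_subspace {s \<in> herm. AE x in F. s \<bullet> x = 0}"
proof
  show "subspace {s \<in> herm. AE x in F. s \<bullet> x = 0}"
    unfolding subspace_def
  proof (intro conjI ballI allI)
    show "0 \<in> {s \<in> herm. AE x in F. s \<bullet> x = 0}"
      using subspace_0[OF subspace_herm] by auto
  next
    fix s t assume st: "s \<in> {s \<in> herm. AE x in F. s \<bullet> x = 0}" "t \<in> {s \<in> herm. AE x in F. s \<bullet> x = 0}"
    then have "AE x in F. s \<bullet> x = 0" "AE x in F. t \<bullet> x = 0" by auto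
    then have "AE x in F. (s + t) \<bullet> x = 0"
      by eventually_elim (simp add: inner_add_left)
    then show "s + t \<in> {s \<in> herm. AE x in F. s \<bullet> x = 0}"
      using st subspace_add[OF subspace_herm] by auto
  next
    fix r s assume s: "s \<in> {s \<in> herm. AE x in F. s \<bullet> x = 0}"
    then have "AE x in F. s \<bullet> x = 0" by auto
    then have "AE x in F. (r *\<^sub>R s) \<bullet> x = 0" by eventually_elim simp
    then show "r *\<^sub>R s \<in> {s \<in> herm. AE x in F. s \<bullet> x = 0}"
      using s subspace_scale[OF subspace_herm] by auto
  qed
qed (use AE_conjugate[OF assms] conjugate_herm in auto)

lemma herm_trace_0_subspace: "subspace (herm_trace 0 :: (complex^'n^'n) set)"
  using subspace_herm
  by (auto simp: subspace_def herm_trace_def trace_add) (auto simp: trace_def simp flip: scaleR_sum_right)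

lemma closed_scalars: "closed {mat (complex_of_real x) :: complex^'n^'n | x. True}"
proof -
  have "{mat (complex_of_real x) :: complex^'n^'n | x. True} = span {mat 1}"
    by (auto simp: span_singleton mat_def vec_eq_iff of_real_def intro!: exI)
  then show ?thesis by simp
qed

subsection \<open>The trichotomy\<close>

text \<open>A finite spanning set turns the family of null sets into a single one. Outside it the
  traceless part T satisfies T . T = T . x - T . (r I) = 0, both terms vanishing because T is itself
  traceless.\<close>

lemma AE_traceless_part_0:
  fixes F :: "(complex^'n^'n) measure"
  assumes herm: "AE x in F. x \<in> herm"
    and null: "\<And>s. s \<in> herm_trace 0 \<Longrightarrow> AE x in F. s \<bullet> x = 0"
  shows "AE x in F. traceless_part x = 0"
proof -
  obtain B :: "(complex^'n^'n) set" where B: "finite B" "B \<subseteq> herm_trace 0" "span B = herm_trace 0"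
    using orthonormal_basis_subspace[OF herm_trace_0_subspace] 
    by (metis independent_imp_finite span_superset)
  have "AE x in F. \<forall>b\<in>B. b \<bullet> x = 0"
    using B null by (intro AE_finite_allI) auto
  with herm show ?thesis
  proof eventually_elim
    fix x :: "complex^'n^'n" assume x: "x \<in> herm" "\<forall>b\<in>B. b \<bullet> x = 0"
    have s0: "s \<bullet> x = 0" if "s \<in> span B" for s
      using that by (induction rule: span_induct_alt) (use x in \<open>auto simp: inner_add_left\<close>)
    define r where "r = Re (trace x) / CARD('n)"
    have mat: "mat (trace x / of_nat CARD('n)) = (mat (complex_of_real r) :: complex^'n^'n)"
      by (subst trace_herm_real[OF x(1)]) (simp add: r_def)
    have tp: "traceless_part x = x - mat (complex_of_real r)"
      unfolding traceless_part_def mat ..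
    have "trace (traceless_part x) = 0"
      unfolding tp trace_sub trace_mat_real using trace_herm_real[OF x(1)] by (simp add: r_def)
    moreover have "traceless_part x \<in> herm"
      unfolding tp using x by (intro subspace_diff subspace_herm mat_real_herm)
    ultimately have T: "traceless_part x \<in> herm_trace 0" by (simp add: herm_trace_def)
    have "traceless_part x \<bullet> traceless_part x = traceless_part x \<bullet> x - mat (complex_of_real r) \<bullet> traceless_part x"
      by (simp add: tp inner_diff_right inner_diff_left inner_commute)
    also have "\<dots> = 0"
      using s0[of "traceless_part x"] T B(3) by (simp add: inner_mat_real herm_trace_def)
    finally show "traceless_part x = 0" by simp
  qed
qed

lemma invariant_stable_cases:
  fixes F :: "(complex^'n^'n) measure"
  assumes N: "CARD('n) \<ge> 2" and ens: "invariant_stable_ensemble F"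
  shows "has_bounded_continuous_density_on F herm \<or>
    (\<exists>t. (AE x in F. x \<in> herm_trace t) \<and> has_bounded_continuous_density_on F (herm_trace t)) \<or>
    (AE x in F. traceless_part x = 0)"
proof -
  have stable: "stable_distribution F" and inv: "unitarily_invariant F"
    using ens by (auto simp: invariant_stable_ensemble_def)
  have F: "prob_space F" "sets F = sets borel" "msupport F \<subseteq> herm"
    using stable by (auto simp: stable_distribution_def)
  have AE_herm: "AE x in F. x \<in> herm"
    using AE_msupport[OF F(2)] F(3) by (auto elim: eventually_mono)
  obtain b where "b > 0" and sim: "\<And>s. cmod (cf F (b *\<^sub>R s)) = (cmod (cf F s))\<^sup>2"
    using stable cf_stable_sum[OF F(1,2)] unfolding stable_distribution_def by blast
  interpret prob_space F by (rule F)
  have nd: "\<not> (\<exists>A. (AE x in F. x = A) \<and> F = return borel A)"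
  proof
    assume "\<exists>A. (AE x in F. x = A) \<and> F = return borel A"
    then obtain A where A: "AE x in F. x = A" "F = return borel A" by blast
    from A(1) AE_herm have "AE x in F. A \<in> herm" by eventually_elim simp
    then have "A \<in> herm" by simp
    then show False using A stable by (auto simp: stable_distribution_def)
  qed
  have b: "b > 1" using self_similar_scale_gt_1[OF F(1,2) \<open>b > 0\<close> sim nd] .
  define V where "V = {s \<in> herm. \<exists>c. AE x in F. s \<bullet> x = c}"
  interpret V: invariant_subspace V
    unfolding V_def using inv F(2) by (rule invariant_const_directions)
  \<comment> \<open>D plays the role of the direction space of S; its trivial intersection with V
    means that no nonzero direction in S is constant.\<close>
  have density: "has_bounded_continuous_density_on F S"
    if S: "affine S" "S \<noteq> {}" "AE x in F. x \<in> S" "D \<subseteq> herm" "subspace D" "D \<inter> V \<subseteq> {0}"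
      and SD: "\<And>x y. x \<in> S \<Longrightarrow> y \<in> S \<Longrightarrow> x - y \<in> D" for S D :: "(complex^'n^'n) set"
  proof (rule has_bounded_continuous_density_on_affine[OF F(1,2) S(1-3)])
    fix k
    have "\<exists>C. \<forall>v\<in>D. cmod (cf F v) * (1 + (norm v)\<^sup>2) ^ k \<le> C"
    proof (rule self_similar_cf_decay[OF F(1,2) b sim S(5)])
      fix v assume "v \<in> D" "v \<noteq> 0"
      then have "\<not> (\<exists>c. AE x in F. v \<bullet> x = c)" using S by (auto simp: V_def)
      then show "cmod (cf F v) < 1" by (rule self_similar_cf_lt_1[OF F(1,2) b sim])
    qed
    then show "\<exists>C. \<forall>x\<in>S. \<forall>y\<in>S. cmod (cf F (x - y)) * (1 + (norm (x - y))\<^sup>2) ^ k \<le> C"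
      using SD by blast
  qed
  \<comment> \<open>The cases lead, in this order, to a density on \<open>herm\<close>, to a
    vanishing traceless part, and to a density on a fixed-trace set.\<close>
  consider "V \<subseteq> {0}" | s where "s \<in> V" "\<And>x::real. s \<noteq> mat (complex_of_real x)"
    | r where "r \<noteq> 0" "mat (complex_of_real r) \<in> V" "\<And>s. s \<in> V \<Longrightarrow> \<exists>x::real. s = mat (complex_of_real x)"
  proof -
    have "\<exists>r. r \<noteq> 0 \<and> mat (complex_of_real r) \<in> V" 
      if ex: "\<not> V \<subseteq> {0}" and all: "\<And>s. s \<in> V \<Longrightarrow> \<exists>x::real. s = mat (complex_of_real x)"
    proof -
      obtain s where s: "s \<in> V" "s \<noteq> 0" using ex by blast
      obtain r where r: "s = mat (complex_of_real r)" using all[OF s(1)] by blast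
      have "r \<noteq> 0" using s(2) by (auto simp: r mat_def vec_eq_iff split: if_splits)
      then show ?thesis using s r by blast
    qed
    then show ?thesis using that by metis
  qed
  then show ?thesis
  proof cases
    case 1
    have "has_bounded_continuous_density_on F herm"
    proof (rule density[of herm herm])
      show "affine (herm :: (complex^'n^'n) set)"
        using subspace_herm by (rule subspace_imp_affine)
      show "herm \<noteq> ({} :: (complex^'n^'n) set)" using subspace_0[OF subspace_herm] by blast
    qed (use AE_herm subspace_herm 1 in \<open>auto intro: subspace_diff\<close>)
    then show ?thesis by blast
  next
    case (2 s)
    have "\<not> card (UNIV :: 'n set) \<le> Suc 0" using N by simp
    then obtain i j :: 'n where ij: "i \<noteq> j" by (auto simp: card_le_Suc0_iff_eq)
    define E where "E = offdiag i j (1::complex)"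
    have "E \<in> V"
      unfolding E_def using 2 offdiag_herm[OF ij] trace_offdiag[OF ij] by (rule V.traceless_subset)
    then obtain c where c: "AE x in F. E \<bullet> x = c" and "E \<in> herm" by (auto simp: V_def)
    define D where "D = diag_matrix (\<lambda>a. if a = i then - 1 else 1 :: complex)"
    have "unitary D" unfolding D_def by (rule unitary_diag_matrix) auto
    from AE_conjugate[OF inv F(2) this \<open>E \<in> herm\<close> c] 
    have "AE x in F. (D ** E ** conj_transpose D) \<bullet> x = c" .
    moreover have "D ** E ** conj_transpose D = - E"
      using ij by (auto simp: vec_eq_iff D_def E_def diag_conjugate_nth offdiag_def)
    ultimately have "AE x in F. - E \<bullet> x = c" by (simp only:)
    with c have "AE x in F. c = 0" by eventually_elim simp
    then have "c = 0" by simp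
    interpret V0: invariant_subspace "{s \<in> herm. AE x in F. s \<bullet> x = 0}"
      using inv F(2) by (rule invariant_null_directions)
    have "s \<in> {s \<in> herm. AE x in F. s \<bullet> x = 0}" if "s \<in> herm_trace 0" for s
    proof (rule V0.traceless_subset[of E])
      show "E \<in> {s \<in> herm. AE x in F. s \<bullet> x = 0}"
        using c \<open>c = 0\<close> \<open>E \<in> herm\<close> by simp
      show "E \<noteq> mat (complex_of_real x)" for x
      proof
        assume "E = mat (complex_of_real x)"
        then have "E $ i $ j = mat (complex_of_real x) $ i $ j" by simp
        then show False using ij by (simp add: E_def offdiag_def mat_def)
      qed
    qed (use that in \<open>auto simp: herm_trace_def\<close>)
    then have "AE x in F. traceless_part x = 0"
      using AE_herm by (intro AE_traceless_part_0) auto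
    then show ?thesis by blast
  next
    case (3 r)
    then obtain c where c: "AE x in F. mat (complex_of_real r) \<bullet> x = c" by (auto simp: V_def)
    \<comment> \<open>The inner product of r I with x is r Tr x for Hermitian x, so the constant c
      fixes the trace at c / r.\<close>
    define t where "t = c / r"
    from c AE_herm have supp: "AE x in F. x \<in> herm_trace t"
    proof eventually_elim
      fix x :: "complex^'n^'n" assume "mat (complex_of_real r) \<bullet> x = c" "x \<in> herm"
      then show "x \<in> herm_trace t"
        using 3(1) trace_herm_real[of x] by (auto simp: herm_trace_def t_def inner_mat_real)
    qed
    have "has_bounded_continuous_density_on F (herm_trace t)"
    proof (rule density[of "herm_trace t" "herm_trace 0"])
      show "herm_trace 0 \<inter> V \<subseteq> {0}"
      proof
        fix s assume s: "s \<in> herm_trace 0 \<inter> V"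
        then obtain x where x: "s = mat (complex_of_real x)" using 3(3) by blast
        have "x * CARD('n) = 0" using s trace_mat_real[of x, where 'n='n]
          by (simp add: x herm_trace_def del: of_real_mult)
        then show "s \<in> {0}" by (simp add: x mat_def vec_eq_iff)
      qed
      show "x - y \<in> herm_trace 0" if "x \<in> herm_trace t" "y \<in> herm_trace t" for x y :: "complex^'n^'n"
        using that subspace_diff[OF subspace_herm] by (auto simp: herm_trace_def trace_sub)
    qed (use supp affine_herm_trace herm_trace_nonempty herm_trace_0_subspace in \<open>auto simp: herm_trace_def\<close>)
    then show ?thesis using supp by blast
  qed
qed

subsection \<open>Exclusivity\<close>

lemma density_herm_imp_not_AE_fixed_trace:
  fixes F :: "(complex^'n^'n) measure"
  assumes F: "prob_space F" and dens: "has_bounded_continuous_density_on F herm"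
  shows "\<not> (AE x in F. x \<in> herm_trace t)"
proof
  assume "AE x in F. x \<in> herm_trace t"
  then have "AE x in F. mat (complex_of_real 1) \<bullet> x = t"
    by eventually_elim (simp only: inner_mat_real herm_trace_def mem_Collect_eq Re_complex_of_real mult_1)
  moreover have "\<not> (AE x in F. mat (complex_of_real 1) \<bullet> x = t)"
  proof (rule density_not_on_hyperplane[OF F dens subspace_imp_affine[OF subspace_herm]])
    show "mat (complex_of_real 1) \<in> (herm :: (complex^'n^'n) set)" by (rule mat_real_herm)
    show "0 \<in> (herm :: (complex^'n^'n) set)" by (rule subspace_0[OF subspace_herm])
    show "mat (complex_of_real 1) \<bullet> mat (complex_of_real 1) \<noteq> mat (complex_of_real 1) \<bullet> (0 :: complex^'n^'n)"
      by (simp only: inner_zero_right inner_mat_real trace_mat_real) simp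
  qed
  ultimately show False by blast
qed

text \<open>Scalar matrices are orthogonal to every off-diagonal matrix, hence lie in a hyperplane
  of \<open>herm\<close> as soon as N >= 2.\<close>

lemma density_herm_imp_not_AE_scalar:
  fixes F :: "(complex^'n^'n) measure"
  assumes N: "CARD('n) \<ge> 2" and F: "prob_space F" and dens: "has_bounded_continuous_density_on F herm"
  shows "\<not> (AE x in F. \<exists>r. x = mat (complex_of_real r))"
proof
  assume AE: "AE x in F. \<exists>r. x = mat (complex_of_real r)"
  have "\<not> card (UNIV :: 'n set) \<le> Suc 0" using N by simp
  then obtain i j :: 'n where ij: "i \<noteq> j" by (auto simp: card_le_Suc0_iff_eq)
  define E where "E = offdiag i j (1::complex)"
  have E: "E \<in> herm" "trace E = 0"
    unfolding E_def using ij by (rule offdiag_herm, rule trace_offdiag)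
  have "E $ i $ j = 1" by (simp add: E_def offdiag_def)
  then have "E \<noteq> 0" by auto
  from AE have "AE x in F. E \<bullet> x = 0"
    by eventually_elim (auto simp: inner_commute[of E] inner_mat_real E)
  moreover have "\<not> (AE x in F. E \<bullet> x = 0)"
  proof (rule density_not_on_hyperplane[OF F dens subspace_imp_affine[OF subspace_herm] E(1)])
    show "0 \<in> (herm :: (complex^'n^'n) set)" by (rule subspace_0[OF subspace_herm])
    show "E \<bullet> E \<noteq> E \<bullet> 0" using \<open>E \<noteq> 0\<close> by simp
  qed
  ultimately show False by blast
qed

text \<open>A scalar matrix is determined by its trace, so both conditions together would give a
  Dirac measure.\<close>

lemma fixed_trace_imp_not_AE_scalar:
  fixes F :: "(complex^'n^'n) measure"
  assumes stable: "stable_distribution F" and t: "AE x in F. x \<in> herm_trace t"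
  shows "\<not> (AE x in F. \<exists>r. x = mat (complex_of_real r))"
proof
  assume "AE x in F. \<exists>r. x = mat (complex_of_real r)"
  with t have "AE x in F. x = mat (complex_of_real (t / CARD('n)))"
  proof eventually_elim
    fix x :: "complex^'n^'n" assume x: "x \<in> herm_trace t" "\<exists>r. x = mat (complex_of_real r)"
    then obtain r where r: "x = mat (complex_of_real r)" by blast
    then have "complex_of_real (r * CARD('n)) = complex_of_real t"
      using x(1) trace_mat_real[of r, where 'n='n] by (simp only: herm_trace_def mem_Collect_eq)
    then have "r * CARD('n) = t" by (simp only: of_real_eq_iff)
    then show "x = mat (complex_of_real (t / CARD('n)))" unfolding r by auto
  qed
  then have "F = return borel (mat (complex_of_real (t / CARD('n))))"
    using stable by (intro AE_const_imp_return) (auto simp: stable_distribution_def)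
  then show False
    using stable mat_real_herm[of "t / CARD('n)"] by (auto simp: stable_distribution_def)
qed

theorem theorem1:
  fixes M :: "'w measure"
    and X :: "'w \<Rightarrow> complex^'n^'n"
    and F :: "(complex^'n^'n) measure"
  assumes N: "CARD('n) \<ge> 2"
    and M: "prob_space M"
    and X_measurable: "X \<in> borel_measurable M"
    and X_herm: "\<forall>\<omega>\<in>space M. X \<omega> \<in> herm"
    and X_nonzero: "\<not> (AE \<omega> in M. X \<omega> = 0)"
    and F: "F = distr M borel X"
    and ensemble: "invariant_stable_ensemble F"
  shows "let
      full_dimensional =
        stable_distribution F \<and> has_bounded_continuous_density_on F herm;
      fixed_trace =
        (\<exists>t::real. stable_distribution F \<and> msupport F \<subseteq> herm_trace t \<and>
           has_bounded_continuous_density_on F (herm_trace t));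
      scalar =
        stable_distribution F \<and> msupport F \<subseteq> {mat (complex_of_real x) | x. True} \<and>
        (AE \<omega> in M. traceless_part (X \<omega>) = 0)
    in (full_dimensional \<and> \<not> fixed_trace \<and> \<not> scalar) \<or>
       (\<not> full_dimensional \<and> fixed_trace \<and> \<not> scalar) \<or>
       (\<not> full_dimensional \<and> \<not> fixed_trace \<and> scalar)"
proof -
  \<comment> \<open>The conjunct \<open>stable_distribution F\<close> is common to all three
    statements and is restored at the end.\<close>
  define full where "full \<longleftrightarrow> has_bounded_continuous_density_on F herm"
  define fixed where "fixed \<longleftrightarrow> (\<exists>t::real. msupport F \<subseteq> herm_trace t \<and>
      has_bounded_continuous_density_on F (herm_trace t))"
  define scalar where "scalar \<longleftrightarrow> msupport F \<subseteq> {mat (complex_of_real x) | x. True} \<and>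
      (AE \<omega> in M. traceless_part (X \<omega>) = 0)"
  have stable: "stable_distribution F" using ensemble by (simp add: invariant_stable_ensemble_def)
  then have PF: "prob_space F" and SF: "sets F = sets borel" by (auto simp: stable_distribution_def)
  \<comment> \<open>Transfer between the law and the random matrix requires measurable predicates;
    the closed sets below supply them.\<close>
  have AE_X: "(AE x in F. P x) \<longleftrightarrow> (AE \<omega> in M. P (X \<omega>))" if "{x. P x} \<in> sets borel" for P
    unfolding F using X_measurable that by (intro AE_distr_iff) auto
  \<comment> \<open>Closedness is what upgrades an almost sure trace condition to one on the
    topological support.\<close>
  have closed_trace: "closed (herm_trace t :: (complex^'n^'n) set)" for t
  proof -
    have "closed {A :: complex^'n^'n. trace A = complex_of_real t}"
      unfolding trace_def by (intro closed_Collect_eq continuous_intros)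
    moreover have "herm_trace t = herm \<inter> {A :: complex^'n^'n. trace A = complex_of_real t}"
      by (auto simp: herm_trace_def)
    ultimately show ?thesis by (simp add: closed_Int closed_subspace subspace_herm)
  qed
  have AE_scalar: "(AE x in F. \<exists>r. x = mat (complex_of_real r)) \<longleftrightarrow> (AE x in F. traceless_part x = 0)"
  proof (intro iffI)
    assume "AE x in F. \<exists>r. x = mat (complex_of_real r)"
    then show "AE x in F. traceless_part x = 0"
    proof eventually_elim
      fix x :: "complex^'n^'n" assume "\<exists>r. x = mat (complex_of_real r)"
      then obtain r where "x = mat (complex_of_real r)" by blast
      then show "traceless_part x = 0"
        by (simp add: traceless_part_def trace_mat_real)
    qed
  next
    have herm: "AE x in F. x \<in> herm"
      using X_herm by (subst AE_X) (auto simp: closed_subspace subspace_herm)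
    assume "AE x in F. traceless_part x = 0"
    with herm show "AE x in F. \<exists>r. x = mat (complex_of_real r)"
    proof eventually_elim
      fix x :: "complex^'n^'n" assume x: "x \<in> herm" "traceless_part x = 0"
      have "x = mat (trace x / of_nat CARD('n))" using x(2) by (simp add: traceless_part_def)
      \<comment> \<open>Hermitian matrices have real trace, so the multiple of the identity is a
        real one, as statement (3) demands.\<close>
      also have "trace x / of_nat CARD('n) = complex_of_real (Re (trace x) / CARD('n))"
        by (subst trace_herm_real[OF x(1)]) simp
      finally show "\<exists>r. x = mat (complex_of_real r)" by blast
    qed
  qed
  have AE_scalar_M: "(AE x in F. \<exists>r. x = mat (complex_of_real r)) \<longleftrightarrow> (AE \<omega> in M. traceless_part (X \<omega>) = 0)"
  proof -
    have cont: "continuous_on UNIV (\<lambda>x::complex^'n^'n. if i = j then trace x / of_nat CARD('n) else 0)" for i j :: 'n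
      unfolding trace_def by (cases "i = j") (auto intro!: continuous_intros)
    have "closed {x :: complex^'n^'n. traceless_part x = 0}"
      unfolding traceless_part_def mat_def
      by (intro closed_Collect_eq continuous_on_diff continuous_on_id continuous_on_const
          continuous_on_vec_lambda cont)
    then show ?thesis unfolding AE_scalar by (intro AE_X) simp
  qed
  have fixedD: "\<exists>t. AE x in F. x \<in> herm_trace t" if fixed
    using that AE_msupport[OF SF] unfolding fixed_def by (auto elim!: eventually_mono)
  have "full \<or> fixed \<or> scalar"
    using invariant_stable_cases[OF N ensemble]
  proof (elim disjE exE conjE)
    fix t assume "AE x in F. x \<in> herm_trace t" "has_bounded_continuous_density_on F (herm_trace t)"
    then have fixed unfolding fixed_def using msupport_subset[OF SF closed_trace] by blast
    then show ?thesis by simp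
  next
    assume "AE x in F. traceless_part x = 0"
    then have *: "AE x in F. \<exists>r. x = mat (complex_of_real r)" by (simp only: AE_scalar)
    then have "msupport F \<subseteq> {mat (complex_of_real x) | x. True}"
      by (intro msupport_subset[OF SF closed_scalars]) (auto elim: eventually_mono)
    with * have scalar by (simp only: scalar_def AE_scalar_M)
    then show ?thesis by simp
  qed (simp add: full_def)
  moreover have "\<not> (full \<and> fixed)" using density_herm_imp_not_AE_fixed_trace[OF PF] fixedD full_def by blast
  moreover have "\<not> (full \<and> scalar)" 
    using density_herm_imp_not_AE_scalar[OF N PF] unfolding full_def scalar_def AE_scalar_M by blast
  moreover have "\<not> (fixed \<and> scalar)" 
    using fixed_trace_imp_not_AE_scalar[OF stable] fixedD unfolding scalar_def AE_scalar_M[symmetric] by blast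
  ultimately show ?thesis
    unfolding Let_def full_def fixed_def scalar_def using stable by blast
qed

end
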